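(* Let $\Gamma\subset\overline{\mathbb{Q}}^*$ be a finitely generated subgroup. The following two assertions are equivalent. (A) There exists a constant $c>0$ such that $h(\alpha)\geq c$ for every $\alpha\in\mathbb{Q}(\Gamma_{\mathrm{div}})^*\setminus\Gamma_{\mathrm{div}}$. (B) For every sequence $(y_n)$ of elements of $\mathbb{Q}(\Gamma_{\mathrm{div}})^*$ such that $h(y_n)\to 0$ and such that $d_{\Gamma,\varepsilon}(y_n)\to 1$ as $n\to+\infty$ for every $\varepsilon>0$, one has $y_n\in\Gamma_{\mathrm{div}}$ for all $n$ large enough.
   Context: Fix an embedding $\overline{\mathbb{Q}}\subset\mathbb{C}$. For $\alpha\in\overline{\mathbb{Q}}$, $h(\alpha)$ denotes the absolute logarithmic Weil height: $h(\alpha)=\frac{1}{[\mathbb{Q}(\alpha):\mathbb{Q}]}\log\big(|lc(\alpha)|\prod_\sigma\max\{1,|\sigma\alpha|\}\big)$, where $lc(\alpha)$ is the leading coefficient of the minimal polynomial of $\alpha$ over $\mathbb{Z}$ and $\sigma$ runs over the field embeddings $\mathbb{Q}(\alpha)\to\overline{\mathbb{Q}}$. The division group $\Gamma_{\mathrm{div}}$ is the set of $\gamma\in\overline{\mathbb{Q}}^*$ such that $\gamma^n\in\Gamma$ for some integer $n\geq1$. Let $\mu_\infty$ be the set of all roots of unity and $K_\Gamma=\mathbb{Q}(\mu_\infty,\Gamma)$. For $\alpha\in\overline{\mathbb{Q}}$, $O_\Gamma(\alpha)$ denotes the orbit of $\alpha$ under $\mathrm{Gal}(\overline{\mathbb{Q}}/K_\Gamma)$,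 and for $\varepsilon>0$, $$d_{\Gamma,\varepsilon}(\alpha)=\frac{\#\{x\in O_\Gamma(\alpha):\ 1-\varepsilon\leq|x|^2\leq1+\varepsilon\}}{\#O_\Gamma(\alpha)}.$$ *)

theory Defs
  imports
    "HOL-Analysis.Analysis"
    "HOL-Computational_Algebra.Polynomial_Factorial"
    "HOL-Algebra.Algebraic_Closure_Type"
    "HOL-Algebra.Generated_Fields"
begin

abbreviation Cfield :: "complex ring"
  where "Cfield \<equiv> ring_of_type_algebra"

abbreviation Cstar :: "complex monoid"
  where "Cstar \<equiv> Multiplicative_Group.mult_of Cfield"

definition Qbar :: "complex set"
  where "Qbar = {z. algebraic z}"

text \<open>For a set \<open>S\<close> of complex numbers, \<open>adjoin S\<close> is the field \<open>\<rat>(S)\<close>, the subfield of the complex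
  numbers generated by \<open>S\<close>; the prime field \<open>\<rat>\<close> is contained in it automatically.\<close>

abbreviation adjoin :: "complex set \<Rightarrow> complex set"
  where "adjoin S \<equiv> generate_field Cfield S"

definition subfield_ring :: "complex set \<Rightarrow> complex ring"
  where "subfield_ring K = Cfield\<lparr>carrier := K\<rparr>"


lemma subfield_adjoin: "subfield (adjoin S) Cfield"
proof -
  interpret field Cfield by (rule field_from_type_algebra)
  show ?thesis by (rule generate_field_is_subfield) (simp add: ring_of_type_algebra_def)
qed

subsection \<open>The absolute logarithmic Weil height\<close>

definition is_min_int_poly :: "complex \<Rightarrow> int poly \<Rightarrow> bool"
  where "is_min_int_poly \<alpha> p \<longleftrightarrow>
    Factorial_Ring.irreducible p \<and> content p = 1 \<and> Polynomial.lead_coeff p > 0 \<and>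
    poly (map_poly of_int p) \<alpha> = 0"

definition min_int_poly :: "complex \<Rightarrow> int poly"
  where "min_int_poly \<alpha> = (THE p. is_min_int_poly \<alpha> p)"

lemma min_int_poly_ex1:
  assumes "algebraic \<alpha>"
  shows "\<exists>!p. is_min_int_poly \<alpha> p"
proof -
  let ?v = "\<lambda>p::int poly. poly (map_poly of_int p) \<alpha>"
  have v_mult: "?v (p * q) = ?v p * ?v q" for p q
  proof -
    have "map_poly of_int (p * q) = (map_poly of_int p * map_poly of_int q :: complex poly)"
      by (intro Polynomial.poly_eqI) (simp add: coeff_map_poly coeff_mult)
    then show ?thesis by simp
  qed
  have v_add: "?v (p + q) = ?v p + ?v q" for p q
  proof -
    have "map_poly of_int (p + q) = (map_poly of_int p + map_poly of_int q :: complex poly)"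
      by (intro Polynomial.poly_eqI) (simp add: coeff_map_poly)
    then show ?thesis by simp
  qed
  have v_const: "?v [:c:] = of_int c" for c
    by (simp add: map_poly_pCons)
  obtain p0 where "p0 \<noteq> 0 \<and> ?v p0 = 0" using assms by (metis algebraicE')
  then obtain p1 where p1: "p1 \<noteq> 0" "?v p1 = 0"
    and p1_min: "\<And>q. q \<noteq> 0 \<Longrightarrow> ?v q = 0 \<Longrightarrow> Polynomial.degree p1 \<le> Polynomial.degree q"
    using ex_has_least_nat[of "\<lambda>p. p \<noteq> 0 \<and> ?v p = 0" p0 Polynomial.degree] by blast
  define p2 where "p2 = primitive_part p1"
  define p where "p = Polynomial.smult (sgn (Polynomial.lead_coeff p2)) p2"
  have p2_0: "p2 \<noteq> 0" using p1 by (simp add: p2_def)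
  have sgn0: "sgn (Polynomial.lead_coeff p2) \<noteq> 0" using p2_0 by (simp add: sgn_eq_0_iff)
  have "p1 = [:Polynomial.content p1:] * p2"
    by (simp add: p2_def)
  then have "?v p1 = of_int (Polynomial.content p1) * ?v p2"
    by (metis v_mult v_const)
  then have v2: "?v p2 = 0" using p1 by auto
  have c: "Polynomial.content p = 1"
    using p1 p2_0 sgn0 unfolding p_def content_smult by (auto simp: p2_def sgn_if)
  have l: "Polynomial.lead_coeff p > 0"
    using sgn0 unfolding p_def lead_coeff_smult by (metis linorder_neqE sgn_0 mult_neg_neg
        mult_pos_pos sgn_less sgn_greater)
  have v: "?v p = 0"
    using v_mult[of "[:sgn (Polynomial.lead_coeff p2):]" p2] v2 by (simp add: p_def)
  have deg: "Polynomial.degree p = Polynomial.degree p1"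
    using sgn0 by (simp add: p_def p2_def)
  have p0: "p \<noteq> 0" using l by auto
  have dpos: "Polynomial.degree p > 0"
  proof (rule ccontr)
    assume "\<not> ?thesis"
    then obtain a where "p = [:a:]" by (metis degree_eq_zeroE gr0I)
    then show False using v v_const p0 by auto
  qed
  have unit_aux: "b dvd 1" if ab: "p = a * b" "?v a = 0" for a b
  proof -
    have nz: "a \<noteq> 0" "b \<noteq> 0" using ab p0 by auto
    then have "Polynomial.degree p \<le> Polynomial.degree a" using p1_min ab deg by auto
    then have "Polynomial.degree b = 0" using ab nz by (simp add: Polynomial.degree_mult_eq)
    then obtain k where k: "b = [:k:]" by (metis degree_eq_zeroE)
    then have "[:k:] dvd p" using ab(1) by (metis dvd_triv_right)
    then have "k dvd 1" using c const_poly_dvd_iff_dvd_content by metis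
    then show ?thesis using k by (simp add: is_unit_const_poly_iff)
  qed
  have irr: "Factorial_Ring.irreducible p"
  proof (rule Factorial_Ring.irreducibleI)
    show "p \<noteq> 0" by (rule p0)
    show "\<not> p dvd 1" using dpos by (auto simp: is_unit_poly_iff)
    fix a b assume ab: "p = a * b"
    then have "?v a = 0 \<or> ?v b = 0" using v v_mult by auto
    then show "a dvd 1 \<or> b dvd 1"
      using unit_aux[of a b] unit_aux[of b a] ab by (auto simp: mult.commute)
  qed
  have ex: "is_min_int_poly \<alpha> p"
    using irr c l v by (simp add: is_min_int_poly_def)
  moreover have "q = p" if q: "is_min_int_poly \<alpha> q" for q
  proof -
    have vq: "?v q = 0" and lq: "Polynomial.lead_coeff q > 0" and iq: "Factorial_Ring.irreducible q"
      using q by (auto simp: is_min_int_poly_def)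
    obtain s r where sr: "pseudo_divmod q p = (s, r)" by (cases "pseudo_divmod q p")
    define k where "k = Polynomial.lead_coeff p ^
      (Suc (Polynomial.degree q) - Polynomial.degree p)"
    have eq: "Polynomial.smult k q = p * s + r"
      and r: "r = 0 \<or> Polynomial.degree r < Polynomial.degree p"
      using pseudo_divmod[OF p0 sr] by (auto simp: k_def)
    have "?v ([:k:] * q) = ?v p * ?v s + ?v r" using eq v_add v_mult by simp
    then have "?v r = 0" using v vq v_mult[of "[:k:]" q] by simp
    then have "r = 0" using r p1_min[of r] deg by linarith
    then have "p dvd [:k:] * q" using eq by simp
    then have "p dvd [:k:] \<or> p dvd q"
      using irr by (metis irreducible_imp_prime_elem prime_elem_dvd_mult_iff)
    moreover have "\<not> p dvd [:k:]"
    proof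
      assume "p dvd [:k:]"
      moreover have "k \<noteq> 0" using p0 by (simp add: k_def)
      ultimately show False using dvd_imp_degree_le[of p "[:k:]"] dpos by auto
    qed
    ultimately have "p dvd q" by blast
    then obtain u where u: "q = p * u" by (elim dvdE)
    then have "u dvd 1" using iq irr
      by (metis Factorial_Ring.irreducibleD Factorial_Ring.irreducible_not_unit)
    then obtain e where e: "u = [:e:]" "e dvd 1" by (auto simp: is_unit_poly_iff)
    then have "e = 1 \<or> e = -1" by (simp add: zdvd1_eq abs_if split: if_splits)
    then show ?thesis using u e lq l by auto
  qed
  ultimately show ?thesis by blast
qed

lemma is_min_int_poly_min_int_poly: "algebraic \<alpha> \<Longrightarrow> is_min_int_poly \<alpha> (min_int_poly \<alpha>)"
  unfolding min_int_poly_def by (rule theI') (rule min_int_poly_ex1)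

definition lc :: "complex \<Rightarrow> int"
  where "lc \<alpha> = Polynomial.lead_coeff (min_int_poly \<alpha>)"

text \<open>The field embeddings of a subfield \<open>K\<close> into \<open>Qbar\<close>. Ring homomorphisms between fields are
  automatically injective. They are made extensional (\<open>undefined\<close> outside \<open>K\<close>), so that each embedding
  is represented by exactly one HOL function and products over all embeddings make sense.\<close>

definition embeddings :: "complex set \<Rightarrow> (complex \<Rightarrow> complex) set"
  where "embeddings K = ring_hom (subfield_ring K) (subfield_ring Qbar) \<inter> extensional K"

definition degree_over_Q :: "complex \<Rightarrow> nat"
  where "degree_over_Q \<alpha> = ring.dim Cfield \<rat> (adjoin {\<alpha>})"

definition weil_height :: "complex \<Rightarrow> real"
  where "weil_height \<alpha> = 1 / real (degree_over_Q \<alpha>) *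
    ln (real_of_int \<bar>lc \<alpha>\<bar> * (\<Prod>\<sigma>\<in>embeddings (adjoin {\<alpha>}). max 1 (cmod (\<sigma> \<alpha>))))"


subsection \<open>Division group, Galois orbits and the density\<close>

definition div_group :: "complex set \<Rightarrow> complex set"
  where "div_group \<Gamma> = {\<gamma> \<in> Qbar - {0}. \<exists>n\<ge>1::nat. \<gamma> ^ n \<in> \<Gamma>}"

definition roots_of_unity :: "complex set"
  where "roots_of_unity = {z. \<exists>n\<ge>1::nat. z ^ n = 1}"

definition K_field :: "complex set \<Rightarrow> complex set"
  where "K_field \<Gamma> = adjoin (roots_of_unity \<union> \<Gamma>)"

definition Gal_Qbar :: "complex set \<Rightarrow> (complex \<Rightarrow> complex) set"
  where "Gal_Qbar K =
    {\<sigma> \<in> ring_iso (subfield_ring Qbar) (subfield_ring Qbar) \<inter> extensional Qbar. \<forall>x\<in>K. \<sigma> x = x}"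

definition galois_orbit :: "complex set \<Rightarrow> complex \<Rightarrow> complex set"
  where "galois_orbit \<Gamma> \<alpha> = (\<lambda>\<sigma>. \<sigma> \<alpha>) ` Gal_Qbar (K_field \<Gamma>)"

definition orbit_density :: "complex set \<Rightarrow> real \<Rightarrow> complex \<Rightarrow> real"
  where "orbit_density \<Gamma> \<epsilon> \<alpha> =
    real (card {x \<in> galois_orbit \<Gamma> \<alpha>. 1 - \<epsilon> \<le> (cmod x)\<^sup>2 \<and> (cmod x)\<^sup>2 \<le> 1 + \<epsilon>}) / real (card (galois_orbit \<Gamma> \<alpha>))"

end

theory Submission
  imports Defs
begin

text \<open>
  (A) implies (B) because a sequence of heights tending to \<open>0\<close> eventually drops below \<open>c\<close>.

  For the converse let \<open>\<alpha>\<close> have small height. By the product formula the mean of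
  \<open>\<bar>ln \<bar>z\<bar>\<bar>\<close> over all conjugates \<open>z\<close> of \<open>\<alpha>\<close> is at most \<open>2 h(\<alpha>)\<close>. Since \<open>\<rat>(\<Gamma>)\<close> is a number
  field, the conjugates over \<open>\<rat>(\<Gamma>)\<close> make up at least a fixed proportion \<open>1 / C\<close> of all of them,
  so their mean is at most \<open>2 C h(\<alpha>)\<close>. The extension \<open>\<rat>(\<mu>\<^sub>\<infinity>, \<Gamma>) / \<rat>(\<Gamma>)\<close> is normal, so this
  orbit splits into orbits over \<open>\<rat>(\<mu>\<^sub>\<infinity>, \<Gamma>)\<close> of equal size, and for some conjugate \<open>\<beta>\<close> of \<open>\<alpha>\<close>
  over \<open>\<rat>(\<Gamma>)\<close> the mean over the orbit of \<open>\<beta>\<close> is at most \<open>2 C h(\<alpha>)\<close>. By Markov's inequality most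
  of that orbit lies near the unit circle. Conjugation over \<open>\<rat>(\<Gamma>)\<close> preserves the height,
  \<open>\<Gamma>\<^sub>d\<^sub>i\<^sub>v\<close> and \<open>\<rat>(\<Gamma>\<^sub>d\<^sub>i\<^sub>v)\<close>, so a sequence of such \<open>\<alpha>\<close> contradicting (A) yields a sequence of
  \<open>\<beta>\<close> contradicting (B).
\<close>

subsection \<open>The field of algebraic numbers\<close>

lemma carrier_Cfield [simp]: "carrier Cfield = UNIV"
  and one_Cfield [simp]: "\<one>\<^bsub>Cfield\<^esub> = 1"
  and zero_Cfield [simp]: "\<zero>\<^bsub>Cfield\<^esub> = 0"
  and add_Cfield [simp]: "x \<oplus>\<^bsub>Cfield\<^esub> y = x + y"
  and mult_Cfield [simp]: "x \<otimes>\<^bsub>Cfield\<^esub> y = x * y"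
  by (simp_all add: ring_of_type_algebra_def)

lemma field_Cfield: "Ring.field Cfield"
  by (rule field_from_type_algebra)

interpretation Cfield: domain Cfield
  by (rule field.axioms(1)[OF field_Cfield])

lemma uminus_Cfield [simp]: "\<ominus>\<^bsub>Cfield\<^esub> x = - x"
  using Cfield.r_neg[of x] by (simp add: eq_neg_iff_add_eq_0 add.commute)

lemma pow_Cfield [simp]: "x [^]\<^bsub>Cfield\<^esub> (n::nat) = x ^ n"
  by (induction n) (simp_all add: mult.commute)

lemma inv_Cfield: "x \<noteq> 0 \<Longrightarrow> inv\<^bsub>Cfield\<^esub> x = inverse x"
  by (rule Cfield.comm_inv_char) simp_all

lemma subfield_CfieldI:
  assumes "1 \<in> K" "\<And>x y. x \<in> K \<Longrightarrow> y \<in> K \<Longrightarrow> x - y \<in> K"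
    "\<And>x y. x \<in> K \<Longrightarrow> y \<in> K \<Longrightarrow> x * y \<in> K" "\<And>x. x \<in> K \<Longrightarrow> inverse x \<in> K"
  shows "subfield K Cfield"
proof -
  have "0 \<in> K" using assms(1) assms(2)[of 1 1] by simp
  then have neg: "- x \<in> K" if "x \<in> K" for x using assms(2)[of 0 x] that by simp
  have add: "x + y \<in> K" if "x \<in> K" "y \<in> K" for x y using assms(2)[of x "-y"] neg that by simp
  have "subring K Cfield"
    by (rule Cfield.subringI) (use assms neg add in simp_all)
  then show ?thesis
    by (rule field.subfieldI'[OF field_Cfield]) (use assms in \<open>auto simp: inv_Cfield\<close>)
qed

lemma subfield_CfieldD:
  assumes "subfield K Cfield"
  shows "0 \<in> K" "1 \<in> K" "\<And>x y. x \<in> K \<Longrightarrow> y \<in> K \<Longrightarrow> x + y \<in> K"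
    "\<And>x. x \<in> K \<Longrightarrow> - x \<in> K" "\<And>x y. x \<in> K \<Longrightarrow> y \<in> K \<Longrightarrow> x - y \<in> K"
    "\<And>x y. x \<in> K \<Longrightarrow> y \<in> K \<Longrightarrow> x * y \<in> K"
    "\<And>x. x \<in> K \<Longrightarrow> inverse x \<in> K"
proof -
  note r = subringE[OF subfieldE(1)[OF assms]]
  show z: "0 \<in> K" and "1 \<in> K" using r(2,3) by simp_all
  show add: "x + y \<in> K" if "x \<in> K" "y \<in> K" for x y using r(7)[OF that] by simp
  show neg: "- x \<in> K" if "x \<in> K" for x using r(5)[OF that] by simp
  show "x - y \<in> K" if "x \<in> K" "y \<in> K" for x y using add[OF that(1) neg[OF that(2)]] by simp
  show "x * y \<in> K" if "x \<in> K" "y \<in> K" for x y using r(6)[OF that] by simp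
  show "inverse x \<in> K" if "x \<in> K" for x
    using Cfield.subfield_m_inv(1)[OF assms, of x] that z by (cases "x = 0") (simp_all add: inv_Cfield)
qed

lemma subfield_Rats: "subfield \<rat> Cfield"
  by (rule subfield_CfieldI) auto

lemma adjoin_subset: "subfield K Cfield \<Longrightarrow> S \<subseteq> K \<Longrightarrow> adjoin S \<subseteq> K"
  by (rule field.generate_field_min_subfield1[OF field_Cfield]) auto

lemma subset_adjoin: "S \<subseteq> adjoin S"
  by (auto intro: generate_field.incl)

lemma Rats_subset_subfield:
  assumes "subfield K Cfield"
  shows "\<rat> \<subseteq> K"
proof
  note K = subfield_CfieldD[OF assms]
  have n: "of_nat n \<in> K" for n by (induction n) (use K in auto)
  have i: "of_int i \<in> K" for i
    by (cases i rule: int_cases2) (use n K(4) in auto)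
  fix x :: complex assume "x \<in> \<rat>"
  then obtain a b :: int where "x = of_int a / of_int b" by (elim Rats_cases') auto
  then show "x \<in> K" using i K(6,7) by (simp add: divide_inverse)
qed

text \<open>HOL-Algebra lists coefficients from the leading one down, \<open>Poly\<close> from the
  constant term up; hence \<open>rev\<close>.\<close>

lemma eval_Cfield: "Cfield.eval p x = poly (Poly (rev p)) x"
  by (induction p) (simp_all add: Poly_append poly_monom)

lemma rat_poly_in_univ_poly:
  assumes "\<And>i. Polynomial.coeff q i \<in> \<rat>" "q \<noteq> 0"
  shows "rev (coeffs q) \<in> carrier (\<rat> [X]\<^bsub>Cfield\<^esub>)"
proof -
  have "hd (rev (coeffs q)) \<noteq> 0" using assms(2) by (simp add: hd_rev last_coeffs_eq_coeff_degree)
  moreover have "set (coeffs q) \<subseteq> \<rat>" using assms(1) by (auto simp: coeffs_def)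
  ultimately show ?thesis by (simp add: univ_poly_def polynomial_def)
qed

lemma univ_poly_rat_poly:
  assumes "p \<in> carrier (\<rat> [X]\<^bsub>Cfield\<^esub>)" "p \<noteq> []"
  shows "Poly (rev p) \<noteq> 0" "Polynomial.coeff (Poly (rev p)) i \<in> \<rat>"
    "Polynomial.degree (Poly (rev p)) = length p - 1"
proof -
  have p': "set p \<subseteq> \<rat>" "hd p \<noteq> 0" using assms by (auto simp: univ_poly_def polynomial_def)
  show "Polynomial.coeff (Poly (rev p)) i \<in> \<rat>"
    using p'(1) nth_mem[of i "rev p"] by (auto simp: nth_default_def)
  have *: "Polynomial.coeff (Poly (rev p)) (length p - 1) \<noteq> 0"
    using p'(2) assms(2) by (simp add: nth_default_def rev_nth hd_conv_nth)
  then show "Poly (rev p) \<noteq> 0" by (metis Polynomial.coeff_0)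
  show "Polynomial.degree (Poly (rev p)) = length p - 1"
  proof (rule antisym)
    show "Polynomial.degree (Poly (rev p)) \<le> length p - 1"
      by (rule degree_le) (auto simp: nth_default_def)
    show "length p - 1 \<le> Polynomial.degree (Poly (rev p))" using * by (rule le_degree)
  qed
qed

lemma algebraic_over_Rats_iff: "(Cfield.algebraic over \<rat>) x \<longleftrightarrow> algebraic x"
proof
  assume "algebraic x"
  then obtain q where q: "\<And>i. Polynomial.coeff q i \<in> \<rat>" "q \<noteq> 0" "poly q x = 0"
    unfolding algebraic_altdef by blast
  show "(Cfield.algebraic over \<rat>) x"
    by (rule Cfield.algebraicI[OF rat_poly_in_univ_poly[OF q(1,2)]]) (use q in \<open>simp_all add: eval_Cfield\<close>)
next
  assume "(Cfield.algebraic over \<rat>) x"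
  then obtain p where p: "p \<in> carrier (\<rat> [X]\<^bsub>Cfield\<^esub>)" "p \<noteq> []" "Cfield.eval p x = 0"
    using Cfield.algebraicE[OF subfieldE(1)[OF subfield_Rats], of x] by auto
  then show "algebraic x"
    using univ_poly_rat_poly[OF p(1,2)] by (intro algebraicI'[of "Poly (rev p)"]) (simp_all add: eval_Cfield)
qed

lemma subfield_Qbar: "subfield Qbar Cfield"
  using field.subfield_of_algebraics[OF field_Cfield subfield_Rats] by (simp add: algebraic_over_Rats_iff Qbar_def)

lemmas Qbar_closed = subfield_CfieldD[OF subfield_Qbar]

lemma Qbar_root:
  assumes "\<gamma> \<in> Qbar" "z ^ n = \<gamma>" "n \<ge> 1"
  shows "z \<in> Qbar"
proof -
  have "algebraic z"
    by (rule algebraic_root[of \<gamma> "Polynomial.monom 1 n"])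
       (use assms in \<open>auto simp: Qbar_def poly_monom Polynomial.degree_monom_eq\<close>)
  then show ?thesis by (simp add: Qbar_def)
qed

subsection \<open>Conjugates and minimal polynomials\<close>

abbreviation poly_of_int :: "int poly \<Rightarrow> complex poly"
  where "poly_of_int \<equiv> map_poly of_int"

lemma poly_of_int_add: "poly_of_int (p + q) = poly_of_int p + poly_of_int q"
  by (intro Polynomial.poly_eqI) (simp add: coeff_map_poly)

lemma poly_of_int_diff: "poly_of_int (p - q) = poly_of_int p - poly_of_int q"
  by (intro Polynomial.poly_eqI) (simp add: coeff_map_poly)

lemma poly_of_int_mult: "poly_of_int (p * q) = poly_of_int p * poly_of_int q"
  by (intro Polynomial.poly_eqI) (simp add: coeff_map_poly coeff_mult)

lemma poly_of_int_smult: "poly_of_int (Polynomial.smult c p) = Polynomial.smult (of_int c) (poly_of_int p)"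
  by (intro Polynomial.poly_eqI) (simp add: coeff_map_poly)

lemma poly_of_int_pderiv: "poly_of_int (pderiv p) = pderiv (poly_of_int p)"
  by (intro Polynomial.poly_eqI) (simp add: coeff_map_poly coeff_pderiv)

lemma poly_of_int_eq_0_iff [simp]: "poly_of_int p = 0 \<longleftrightarrow> p = 0"
  by (auto simp: Polynomial.poly_eq_iff coeff_map_poly)

lemma degree_poly_of_int [simp]: "Polynomial.degree (poly_of_int p) = Polynomial.degree p"
  by (rule Polynomial.degree_map_poly) simp

text \<open>Let \<open>m\<close> have least degree among the nonzero integer polynomials vanishing
  at \<open>x\<close>. Pseudo-division of \<open>p\<close> by \<open>m\<close> leaves no remainder.
  Being prime, \<open>p\<close> divides \<open>m\<close> or the cofactor \<open>s\<close>; in the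
  second case \<open>m\<close> would divide a nonzero constant, impossible as \<open>m\<close> has
  the root \<open>x\<close>.\<close>

lemma irreducible_degree_le:
  fixes p f :: "int poly"
  assumes "Factorial_Ring.irreducible p" "poly (poly_of_int p) x = 0"
    and "f \<noteq> 0" "poly (poly_of_int f) x = 0"
  shows "Polynomial.degree p \<le> Polynomial.degree f"
proof -
  obtain m where m: "m \<noteq> 0" "poly (poly_of_int m) x = 0"
    and m_min: "\<And>q. q \<noteq> 0 \<Longrightarrow> poly (poly_of_int q) x = 0 \<Longrightarrow> Polynomial.degree m \<le> Polynomial.degree q"
    using ex_has_least_nat[of "\<lambda>p. p \<noteq> 0 \<and> poly (poly_of_int p) x = 0" f Polynomial.degree] assms by blast
  have not_const: "\<not> g dvd [:c:]" if "poly (poly_of_int g) x = 0" "c \<noteq> 0" for g c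
  proof
    assume "g dvd [:c:]"
    then obtain h where "[:c:] = g * h" by (elim dvdE)
    then have "poly (poly_of_int [:c:]) x = 0" using that(1) by (simp add: poly_of_int_mult)
    then show False using that(2) by (simp add: map_poly_pCons)
  qed
  obtain s r where sr: "pseudo_divmod p m = (s, r)" by (cases "pseudo_divmod p m")
  define k where "k = Polynomial.lead_coeff m ^ (Suc (Polynomial.degree p) - Polynomial.degree m)"
  have k0: "k \<noteq> 0" using m by (simp add: k_def)
  have eq: "Polynomial.smult k p = m * s + r"
    and r: "r = 0 \<or> Polynomial.degree r < Polynomial.degree m"
    using pseudo_divmod[OF m(1) sr] by (auto simp: k_def)
  have "poly (poly_of_int (Polynomial.smult k p)) x = poly (poly_of_int (m * s + r)) x" by (simp only: eq)
  then have "poly (poly_of_int r) x = 0"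
    using m assms by (simp add: poly_of_int_add poly_of_int_mult poly_of_int_smult)
  then have "r = 0" using r m_min[of r] by linarith
  then have eq': "[:k:] * p = m * s" using eq by simp
  have nz: "p \<noteq> 0" "s \<noteq> 0" using assms(1) eq' k0 by auto
  have "p dvd m * s" using eq' by (metis dvd_triv_right)
  then have "p dvd m \<or> p dvd s"
    using assms(1) by (metis irreducible_imp_prime_elem prime_elem_dvd_mult_iff)
  then have "p dvd m"
  proof
    assume "p dvd s"
    then obtain t where "s = p * t" by (elim dvdE)
    then have "p * [:k:] = p * (m * t)" using eq' by (simp add: mult.left_commute)
    then have "[:k:] = m * t" using nz(1) by (metis mult_cancel_left)
    then have "m dvd [:k:]" by simp
    then show ?thesis using not_const m(2) k0 by blast
  qed
  then have "Polynomial.degree p \<le> Polynomial.degree m" using m(1) by (rule dvd_imp_degree_le)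
  then show ?thesis using m_min[of f] assms by linarith
qed

text \<open>The pseudo-remainder of \<open>f\<close> by \<open>p\<close> vanishes at
  \<open>x\<close> and is therefore zero by \<open>irreducible_degree_le\<close>. So the prime
  \<open>p\<close> divides \<open>f\<close> times a nonzero integer \<open>k\<close>, and having the
  root \<open>x\<close> it cannot divide \<open>k\<close>.\<close>

lemma irreducible_dvd:
  fixes p f :: "int poly"
  assumes p: "Factorial_Ring.irreducible p" "poly (poly_of_int p) x = 0" and f: "poly (poly_of_int f) x = 0"
  shows "p dvd f"
proof -
  have p0: "p \<noteq> 0" using p by auto
  obtain s r where sr: "pseudo_divmod f p = (s, r)" by (cases "pseudo_divmod f p")
  define k where "k = Polynomial.lead_coeff p ^ (Suc (Polynomial.degree f) - Polynomial.degree p)"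
  have k0: "k \<noteq> 0" using p0 by (simp add: k_def)
  have eq: "Polynomial.smult k f = p * s + r"
    and r: "r = 0 \<or> Polynomial.degree r < Polynomial.degree p"
    using pseudo_divmod[OF p0 sr] by (auto simp: k_def)
  have "poly (poly_of_int (Polynomial.smult k f)) x = poly (poly_of_int (p * s + r)) x" by (simp only: eq)
  then have "poly (poly_of_int r) x = 0"
    using p f by (simp add: poly_of_int_add poly_of_int_mult poly_of_int_smult)
  then have "r = 0" using r irreducible_degree_le[OF p, of r] by linarith
  then have "p dvd [:k:] * f" using eq by simp
  then have "p dvd [:k:] \<or> p dvd f"
    using p(1) by (metis irreducible_imp_prime_elem prime_elem_dvd_mult_iff)
  moreover have "\<not> p dvd [:k:]"
  proof
    assume "p dvd [:k:]"
    then obtain h where "[:k:] = p * h" by (elim dvdE)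
    then have "poly (poly_of_int [:k:]) x = 0" using p(2) by (simp add: poly_of_int_mult)
    then show False using k0 by (simp add: map_poly_pCons)
  qed
  ultimately show ?thesis by blast
qed

text \<open>A set without multiplicities counts the conjugates correctly, since all roots are simple
  by \<open>min_int_poly_factorization\<close>.\<close>

definition conjugates :: "complex \<Rightarrow> complex set"
  where "conjugates \<alpha> = {z. poly (poly_of_int (min_int_poly \<alpha>)) z = 0}"

context
  fixes \<alpha> :: complex assumes alg: "algebraic \<alpha>"
begin

lemma min_int_poly_irreducible: "Factorial_Ring.irreducible (min_int_poly \<alpha>)"
  and min_int_poly_root: "poly (poly_of_int (min_int_poly \<alpha>)) \<alpha> = 0"
  and min_int_poly_lc_pos: "Polynomial.lead_coeff (min_int_poly \<alpha>) > 0"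
  using is_min_int_poly_min_int_poly[OF alg] by (auto simp: is_min_int_poly_def)

lemma min_int_poly_nonzero: "min_int_poly \<alpha> \<noteq> 0"
  using min_int_poly_irreducible by auto

lemma conjugate_algebraic: "\<beta> \<in> conjugates \<alpha> \<Longrightarrow> algebraic \<beta>"
  using min_int_poly_nonzero
  by (intro algebraicI[of "poly_of_int (min_int_poly \<alpha>)"]) (auto simp: conjugates_def coeff_map_poly)

lemma min_int_poly_conjugate:
  assumes "\<beta> \<in> conjugates \<alpha>"
  shows "min_int_poly \<beta> = min_int_poly \<alpha>"
proof -
  have "is_min_int_poly \<beta> (min_int_poly \<alpha>)"
    using is_min_int_poly_min_int_poly[OF alg] assms by (auto simp: is_min_int_poly_def conjugates_def)
  then show ?thesis
    using conjugate_algebraic[OF assms] min_int_poly_ex1 is_min_int_poly_min_int_poly by blast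
qed

lemma conjugate_self: "\<alpha> \<in> conjugates \<alpha>"
  using min_int_poly_root by (simp add: conjugates_def)

text \<open>Makes the map f(\<alpha>) -> f(\<beta>) in \<open>Gal_Qbar_transitive\<close> well
  defined.\<close>

lemma conjugate_vanish:
  assumes "\<beta> \<in> conjugates \<alpha>" "poly (poly_of_int f) \<alpha> = 0"
  shows "poly (poly_of_int f) \<beta> = 0"
proof -
  have "min_int_poly \<alpha> dvd f" by (rule irreducible_dvd[OF min_int_poly_irreducible min_int_poly_root assms(2)])
  then show ?thesis using assms(1) by (auto simp: conjugates_def poly_of_int_mult elim!: dvdE)
qed

lemma finite_conjugates: "finite (conjugates \<alpha>)"
  unfolding conjugates_def using min_int_poly_nonzero by (intro poly_roots_finite) simp

text \<open>A repeated root would be a root of the derivative too, which is nonzero and of smaller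
  degree, against \<open>irreducible_degree_le\<close>.\<close>

lemma min_int_poly_factorization:
  "poly_of_int (min_int_poly \<alpha>) = Polynomial.smult (of_int (lc \<alpha>)) (\<Prod>z\<in>conjugates \<alpha>. [:- z, 1:])"
proof -
  let ?p = "min_int_poly \<alpha>"
  have "rsquarefree (poly_of_int ?p)"
    unfolding rsquarefree_roots
  proof safe
    fix a assume a: "poly (poly_of_int ?p) a = 0" "poly (pderiv (poly_of_int ?p)) a = 0"
    have "?p \<noteq> 0" by (rule min_int_poly_nonzero)
    have "Polynomial.degree ?p \<noteq> 0"
    proof
      assume "Polynomial.degree ?p = 0"
      then obtain c where "?p = [:c:]" by (metis degree_eq_zeroE)
      then show False using \<open>?p \<noteq> 0\<close> min_int_poly_root by (auto simp: map_poly_pCons)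
    qed
    moreover from this have "pderiv ?p \<noteq> 0" by (simp add: pderiv_eq_0_iff)
    then have "Polynomial.degree ?p \<le> Polynomial.degree (pderiv ?p)"
      using irreducible_degree_le[OF min_int_poly_irreducible a(1)] a(2) by (simp add: poly_of_int_pderiv)
    ultimately show False by (simp add: degree_pderiv)
  qed
  moreover have "Polynomial.lead_coeff (poly_of_int ?p) = of_int (lc \<alpha>)"
    by (simp add: lc_def coeff_map_poly)
  ultimately show ?thesis
    using complex_poly_decompose_rsquarefree unfolding conjugates_def by metis
qed

lemma degree_min_int_poly: "Polynomial.degree (min_int_poly \<alpha>) = card (conjugates \<alpha>)"
proof -
  have "lc \<alpha> \<noteq> 0" using min_int_poly_nonzero by (simp add: lc_def)
  have "Polynomial.degree (poly_of_int (min_int_poly \<alpha>)) = card (conjugates \<alpha>)"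
    unfolding min_int_poly_factorization using \<open>lc \<alpha> \<noteq> 0\<close>
    by (simp add: Polynomial.degree_prod_eq_sum_degree)
  then show ?thesis by simp
qed

text \<open>The product of the \<open>\<bar>z\<bar>\<close> is \<open>\<bar>c\<^sub>0\<bar> / lc \<alpha>\<close>, where the constant coefficient \<open>c\<^sub>0\<close> is a nonzero
  integer; so the negative part of \<open>\<Sum> ln \<bar>z\<bar>\<close> is controlled by the positive part.\<close>

lemma sum_abs_ln_conjugates_le:
  assumes "\<alpha> \<noteq> 0"
  shows "(\<Sum>z\<in>conjugates \<alpha>. \<bar>ln (cmod z)\<bar>) \<le>
    2 * ln (real_of_int \<bar>lc \<alpha>\<bar> * (\<Prod>z\<in>conjugates \<alpha>. max 1 (cmod z)))"
proof -
  let ?p = "min_int_poly \<alpha>" and ?R = "conjugates \<alpha>"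
  note fin = finite_conjugates
  \<comment> \<open>If 0 were a root, the irreducible \<open>?p\<close> would divide X, and
    evaluation at \<alpha> would give \<alpha> = 0.\<close>
  have c0: "Polynomial.coeff ?p 0 \<noteq> 0"
  proof
    assume "Polynomial.coeff ?p 0 = 0"
    then have "poly (poly_of_int ?p) 0 = 0" by (simp add: poly_0_coeff_0 coeff_map_poly)
    from irreducible_dvd[OF min_int_poly_irreducible this, of "[:0, 1:]"]
    have "?p dvd [:0, 1:]" by (simp add: map_poly_pCons)
    then obtain h where "[:0, 1:] = ?p * h" by (elim dvdE)
    then have "poly (poly_of_int [:0, 1:]) \<alpha> = 0" using min_int_poly_root by (simp add: poly_of_int_mult)
    then show False using assms by (simp add: map_poly_pCons)
  qed
  have nz: "z \<noteq> 0" if "z \<in> ?R" for z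
  proof
    assume "z = 0"
    then show False using that c0 by (simp add: conjugates_def poly_0_coeff_0 coeff_map_poly)
  qed
  have l: "lc \<alpha> \<ge> 1" using min_int_poly_lc_pos by (simp add: lc_def)
  have "of_int (Polynomial.coeff ?p 0) = poly (poly_of_int ?p) 0"
    by (simp add: poly_0_coeff_0 coeff_map_poly)
  also have "\<dots> = of_int (lc \<alpha>) * (\<Prod>z\<in>?R. - z)"
    by (subst min_int_poly_factorization) (simp add: poly_prod)
  finally have "cmod (of_int (Polynomial.coeff ?p 0)) = of_int (lc \<alpha>) * (\<Prod>z\<in>?R. cmod z)"
    using l by (simp add: norm_mult prod_norm[symmetric])
  moreover have "cmod (of_int (Polynomial.coeff ?p 0)) \<ge> 1" using c0 by simp
  ultimately have "of_int (lc \<alpha>) * (\<Prod>z\<in>?R. cmod z) \<ge> 1" by simp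
  then have "0 \<le> ln (of_int (lc \<alpha>) * (\<Prod>z\<in>?R. cmod z))" by simp
  also have "\<dots> = ln (of_int (lc \<alpha>)) + (\<Sum>z\<in>?R. ln (cmod z))"
    using l nz fin by (subst ln_mult) (auto simp: ln_prod prod_zero_iff prod_pos)
  finally have 1: "0 \<le> ln (of_int (lc \<alpha>)) + (\<Sum>z\<in>?R. ln (cmod z))" .
  have pos: "(\<Prod>z\<in>?R. max 1 (cmod z)) > 0"
    by (intro prod_pos) (simp add: less_max_iff_disj)
  have "ln (real_of_int \<bar>lc \<alpha>\<bar> * (\<Prod>z\<in>?R. max 1 (cmod z))) = ln (of_int (lc \<alpha>)) + ln (\<Prod>z\<in>?R. max 1 (cmod z))"
    using l pos by (subst ln_mult) simp_all
  also have "ln (\<Prod>z\<in>?R. max 1 (cmod z)) = (\<Sum>z\<in>?R. ln (max 1 (cmod z)))"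
    by (rule ln_prod) (simp_all add: fin less_max_iff_disj)
  finally have 2: "ln (real_of_int \<bar>lc \<alpha>\<bar> * (\<Prod>z\<in>?R. max 1 (cmod z))) = ln (of_int (lc \<alpha>)) + (\<Sum>z\<in>?R. ln (max 1 (cmod z)))" .
  \<comment> \<open>With t = ln |z| this is |t| = 2 max(0, t) - t. By \<open>1\<close> the terms -t
    sum to at most \<open>ln (lc \<alpha>)\<close>, which is nonnegative and so at most its double
    in the bound.\<close>
  have "\<bar>ln (cmod z)\<bar> = 2 * ln (max 1 (cmod z)) - ln (cmod z)" if "z \<in> ?R" for z
    using nz[OF that] by (auto simp: max_def)
  then have "(\<Sum>z\<in>?R. \<bar>ln (cmod z)\<bar>) = 2 * (\<Sum>z\<in>?R. ln (max 1 (cmod z))) - (\<Sum>z\<in>?R. ln (cmod z))"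
    by (simp add: sum_subtractf sum_distrib_left)
  moreover have "ln (real_of_int (lc \<alpha>)) \<ge> 0" using l by simp
  ultimately show ?thesis using 1 unfolding 2 distrib_left by linarith
qed

end

subsection \<open>Extending embeddings to automorphisms\<close>

text \<open>\<open>G\<close> is the graph of an embedding into \<open>Qbar\<close> of a subring of \<open>Qbar\<close>.\<close>

definition partial_embedding :: "(complex \<times> complex) set \<Rightarrow> bool"
  where "partial_embedding G \<longleftrightarrow> G \<subseteq> Qbar \<times> Qbar \<and> (1, 1) \<in> G \<and>
    (\<forall>a b c d. (a, b) \<in> G \<longrightarrow> (c, d) \<in> G \<longrightarrow> (a - c, b - d) \<in> G \<and> (a * c, b * d) \<in> G) \<and>
    (\<forall>y. (0, y) \<in> G \<longrightarrow> y = 0)"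

context
  fixes G assumes G: "partial_embedding G"
begin

lemma partial_embedding_Qbar: "(a, b) \<in> G \<Longrightarrow> a \<in> Qbar \<and> b \<in> Qbar"
  and partial_embedding_one: "(1, 1) \<in> G"
  and partial_embedding_diff: "(a, b) \<in> G \<Longrightarrow> (c, d) \<in> G \<Longrightarrow> (a - c, b - d) \<in> G"
  and partial_embedding_mult: "(a, b) \<in> G \<Longrightarrow> (c, d) \<in> G \<Longrightarrow> (a * c, b * d) \<in> G"
  and partial_embedding_zeroD: "(0, b) \<in> G \<Longrightarrow> b = 0"
  using G unfolding partial_embedding_def by blast+

lemma partial_embedding_zero: "(0, 0) \<in> G"
  using partial_embedding_diff[OF partial_embedding_one partial_embedding_one] by simp

lemma partial_embedding_add: "(a, b) \<in> G \<Longrightarrow> (c, d) \<in> G \<Longrightarrow> (a + c, b + d) \<in> G"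
  using partial_embedding_diff[OF _ partial_embedding_diff[OF partial_embedding_zero]] by fastforce

lemma partial_embedding_sum:
  "(\<And>i. i \<in> A \<Longrightarrow> (f i, g i) \<in> G) \<Longrightarrow> (sum f A, sum g A) \<in> G"
  by (induction A rule: infinite_finite_induct)
     (auto intro: partial_embedding_zero partial_embedding_add)

lemma partial_embedding_of_int: "(of_int n, of_int n) \<in> G"
proof -
  have *: "(of_nat n, of_nat n) \<in> G" for n
    by (induction n) (auto intro: partial_embedding_zero partial_embedding_add partial_embedding_one)
  show ?thesis
    using * partial_embedding_diff[OF partial_embedding_zero *]
    by (cases n rule: int_cases2) auto
qed

lemma partial_embedding_poly_of_int:
  assumes "(a, b) \<in> G"
  shows "(poly (poly_of_int f) a, poly (poly_of_int f) b) \<in> G"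
proof (induction f)
  case (pCons c f)
  then show ?case
    using assms by (simp add: map_poly_pCons partial_embedding_add partial_embedding_mult partial_embedding_of_int)
qed (simp add: partial_embedding_zero)

text \<open>This holds because nonzero algebraic numbers divide nonzero integers.\<close>

lemma partial_embedding_inj_zero:
  assumes "(a, 0) \<in> G"
  shows "a = 0"
proof (rule ccontr)
  assume "a \<noteq> 0"
  moreover have "algebraic a" using partial_embedding_Qbar[OF assms] by (simp add: Qbar_def)
  ultimately obtain f where f: "Polynomial.coeff f 0 \<noteq> 0" "poly (poly_of_int f) a = 0"
    using algebraicE'_nonzero by metis
  have "poly (poly_of_int f) 0 = 0"
    using partial_embedding_zeroD partial_embedding_poly_of_int[OF assms, of f] f(2) by simp
  then show False using f(1) by (simp add: poly_0_coeff_0 coeff_map_poly)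
qed

text \<open>Exchanges domain and range, so that an extension of the converse enlarges the range of
  \<open>G\<close>.\<close>

lemma partial_embedding_converse: "partial_embedding (G\<inverse>)"
  unfolding partial_embedding_def
  using partial_embedding_Qbar partial_embedding_one partial_embedding_diff partial_embedding_mult
    partial_embedding_inj_zero by auto

text \<open>Take a nonzero polynomial \<open>p\<close> of least degree over the domain of
  \<open>G\<close> with root \<open>x\<close>, let \<open>q\<close> be its image under
  \<open>G\<close>, and send \<open>x\<close> to any root \<open>y\<close> of \<open>q\<close>.
  Evaluating corresponding polynomials at \<open>x\<close> and \<open>y\<close> gives
  \<open>G'\<close>. The domain of \<open>G\<close> is only a ring, so leading coefficients are
  cleared by cross-multiplication instead of division.\<close>

lemma partial_embedding_extend:
  assumes x: "x \<in> Qbar"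
  shows "\<exists>y G'. partial_embedding G' \<and> G \<subseteq> G' \<and> (x, y) \<in> G'"
proof -
  \<comment> \<open>\<open>P\<close> is the map that \<open>G\<close> induces on polynomials,
    applied coefficientwise.\<close>
  define P where "P = {(p, q). \<forall>i. (Polynomial.coeff p i, Polynomial.coeff q i) \<in> G}"
  have P_diff: "(p - r, q - s) \<in> P" if "(p, q) \<in> P" "(r, s) \<in> P" for p q r s
    using that by (auto simp: P_def partial_embedding_diff)
  have P_mult: "(p * r, q * s) \<in> P" if "(p, q) \<in> P" "(r, s) \<in> P" for p q r s
    using that by (auto simp: P_def coeff_mult intro!: partial_embedding_sum partial_embedding_mult)
  have P_const: "([:a:], [:b:]) \<in> P" if "(a, b) \<in> G" for a b
    using that by (auto simp: P_def coeff_pCons partial_embedding_zero split: nat.splits)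
  have P_monom: "(Polynomial.monom 1 n, Polynomial.monom 1 n) \<in> P" for n
    by (auto simp: P_def partial_embedding_zero partial_embedding_one)
  have P_int: "(poly_of_int f, poly_of_int f) \<in> P" for f
    by (auto simp: P_def coeff_map_poly partial_embedding_of_int)
  have P_0: "s = 0" if "(0, s) \<in> P" for s
    using that by (intro Polynomial.poly_eqI) (auto simp: P_def partial_embedding_zeroD)
  define f where "f = min_int_poly x"
  have f: "f \<noteq> 0" "poly (poly_of_int f) x = 0"
    using x min_int_poly_nonzero min_int_poly_root by (auto simp: f_def Qbar_def)
  \<comment> \<open>The integer polynomial \<open>f\<close>, which corresponds to itself, shows that
    such pairs exist.\<close>
  obtain p q where pq: "(p, q) \<in> P" "p \<noteq> 0" "poly p x = 0"
    and p_min: "\<And>r s. (r, s) \<in> P \<Longrightarrow> r \<noteq> 0 \<Longrightarrow> poly r x = 0 \<Longrightarrow> Polynomial.degree p \<le> Polynomial.degree r"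
    using ex_has_least_nat[of "\<lambda>(p, q). (p, q) \<in> P \<and> p \<noteq> 0 \<and> poly p x = 0" "(poly_of_int f, poly_of_int f)"
        "\<lambda>(p, q). Polynomial.degree p"] P_int f by force
  define n where "n = Polynomial.degree p"
  define a where "a = Polynomial.coeff p n"
  define b where "b = Polynomial.coeff q n"
  have ab: "(a, b) \<in> G" using pq(1) by (simp add: P_def a_def b_def)
  have a0: "a \<noteq> 0" using pq(2) by (simp add: a_def n_def)
  have b0: "b \<noteq> 0" using ab a0 partial_embedding_inj_zero by blast
  have n0: "n > 0"
  proof (rule ccontr)
    assume "\<not> n > 0"
    then obtain c where "p = [:c:]" unfolding n_def by (metis degree_eq_zeroE gr0I)
    then show False using pq by auto
  qed
  \<comment> \<open>The coefficient of \<open>q\<close> at the positive index \<open>n\<close> is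
    \<open>b\<close>, nonzero because \<open>G\<close> is injective; so \<open>q\<close> is not
    constant and has a complex root.\<close>
  have "Polynomial.degree q \<noteq> 0"
    using b0 n0 le_degree[of q n] by (auto simp: b_def)
  then obtain y where y: "poly q y = 0"
    using fundamental_theorem_of_algebra[of q] by (auto simp: constant_degree)
  \<comment> \<open>This makes \<open>G'\<close> single-valued. Subtracting multiples of
    \<open>p\<close> and \<open>q\<close> in parallel cancels the leading term of \<open>r\<close>,
    and the induction hypothesis then gives b s(y) = 0.\<close>
  have vanish: "poly s y = 0" if "(r, s) \<in> P" "poly r x = 0" for r s
    using that
  proof (induction "Polynomial.degree r" arbitrary: r s rule: less_induct)
    case less
    show ?case
    proof (cases "r = 0")
      case True
      then have "s = 0" using less.prems(1) P_0 by blast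
      then show ?thesis by simp
    next
      case False
      define m where "m = Polynomial.degree r"
      define c where "c = Polynomial.coeff r m"
      define d where "d = Polynomial.coeff s m"
      have cd: "(c, d) \<in> G" using less.prems by (simp add: P_def c_def d_def)
      have nm: "n \<le> m" using p_min[OF less.prems(1) False less.prems(2)] by (simp add: n_def m_def)
      define r' where "r' = [:a:] * r - [:c:] * (Polynomial.monom 1 (m - n) * p)"
      define s' where "s' = [:b:] * s - [:d:] * (Polynomial.monom 1 (m - n) * q)"
      have "(r', s') \<in> P" unfolding r'_def s'_def
        by (intro P_diff P_mult P_const P_monom ab cd less.prems pq(1))
      moreover have "poly r' x = 0" using less.prems(2) pq(3) by (simp add: r'_def)
      moreover have "Polynomial.degree r' < m"
      \<comment> \<open>All coefficients of \<open>r'\<close> from index \<open>m\<close> on vanish;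
        \<open>m > 0\<close> covers the case \<open>r' = 0\<close>, whose degree is 0 by
        convention.\<close>
      proof -
        have "Polynomial.coeff r' i = 0" if "i \<ge> m" for i
        proof (cases "i = m")
          case True
          have "Polynomial.coeff (Polynomial.monom 1 (m - n) * p) m = a"
            using nm by (simp add: coeff_monom_mult a_def)
          then show ?thesis using True by (simp add: r'_def c_def)
        next
          case False
          then have "i > m" using that by simp
          moreover from this have "Polynomial.coeff p (i - (m - n)) = 0"
            using nm by (intro coeff_eq_0) (simp add: n_def)
          ultimately show ?thesis
            by (simp add: r'_def coeff_monom_mult coeff_eq_0 m_def)
        qed
        then show ?thesis using nm n0
          by (metis Polynomial.degree_0 leading_coeff_0_iff less_le_trans not_le)
      qed
      ultimately have "poly s' y = 0" using less.hyps unfolding m_def by blast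
      then show ?thesis using y b0 by (simp add: s'_def)
    qed
  qed
  \<comment> \<open>The root \<open>y\<close> is algebraic because \<open>f\<close> also vanishes
    there.\<close>
  have "poly (poly_of_int f) y = 0" using vanish[OF P_int f(2)] .
  then have yQ: "y \<in> Qbar"
    using conjugate_algebraic[of x y] x by (simp add: Qbar_def conjugates_def f_def)
  define G' where "G' = (\<lambda>(p, q). (poly p x, poly q y)) ` P"
  have G'I: "(poly p x, poly q y) \<in> G'" if "(p, q) \<in> P" for p q
    using that by (force simp: G'_def)
  have Qbar_poly: "poly p z \<in> Qbar" if "\<And>i. Polynomial.coeff p i \<in> Qbar" "z \<in> Qbar" for p z
  proof -
    have "z ^ i \<in> Qbar" for i by (induction i) (use that(2) Qbar_closed in auto)
    then have "Polynomial.coeff p i * z ^ i \<in> Qbar" for i using that Qbar_closed by auto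
    then have "(\<Sum>i\<in>A. Polynomial.coeff p i * z ^ i) \<in> Qbar" for A
      by (induction A rule: infinite_finite_induct) (use Qbar_closed in auto)
    then show ?thesis by (simp add: poly_altdef)
  qed
  have GG': "G \<subseteq> G'" using G'I[OF P_const] by auto
  have "partial_embedding G'"
    unfolding partial_embedding_def
  proof (intro conjI allI impI)
    show "G' \<subseteq> Qbar \<times> Qbar"
      unfolding G'_def by (auto simp: P_def intro!: Qbar_poly x yQ dest: partial_embedding_Qbar)
    show "(1, 1) \<in> G'" using GG' partial_embedding_one by blast
    fix a b c d assume "(a, b) \<in> G'" "(c, d) \<in> G'"
    then obtain p q r s where *: "(p, q) \<in> P" "(r, s) \<in> P" "a = poly p x" "b = poly q y" "c = poly r x" "d = poly s y"
      by (auto simp: G'_def)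
    show "(a - c, b - d) \<in> G'" using G'I[OF P_diff[OF *(1,2)]] * by simp
    show "(a * c, b * d) \<in> G'" using G'I[OF P_mult[OF *(1,2)]] * by simp
  next
    fix w assume "(0, w) \<in> G'"
    then obtain r s where "(r, s) \<in> P" "0 = poly r x" "w = poly s y" by (auto simp: G'_def)
    then show "w = 0" using vanish by metis
  qed
  moreover have "(x, y) \<in> G'" using G'I[OF P_monom[of 1]] by (simp add: poly_monom)
  ultimately show ?thesis using GG' by blast
qed

end

text \<open>Two pairs from a chain lie in a common member, which supplies their difference and
  product. This is the upper bound for Zorn's lemma.\<close>

lemma partial_embedding_Union:
  assumes "C \<noteq> {}" "\<And>G. G \<in> C \<Longrightarrow> partial_embedding G" "\<And>G H. G \<in> C \<Longrightarrow> H \<in> C \<Longrightarrow> G \<subseteq> H \<or> H \<subseteq> G"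
  shows "partial_embedding (\<Union>C)"
  unfolding partial_embedding_def
proof (intro conjI allI impI)
  show "\<Union>C \<subseteq> Qbar \<times> Qbar" using assms(2) unfolding partial_embedding_def by blast
  show "(1, 1) \<in> \<Union>C" using assms(1,2) unfolding partial_embedding_def by blast
  fix a b c d assume "(a, b) \<in> \<Union>C" "(c, d) \<in> \<Union>C"
  then obtain G where G: "G \<in> C" "(a, b) \<in> G" "(c, d) \<in> G" using assms(3) by blast
  show "(a - c, b - d) \<in> \<Union>C" using partial_embedding_diff[OF assms(2)] G by blast
  show "(a * c, b * d) \<in> \<Union>C" using partial_embedding_mult[OF assms(2)] G by blast
next
  show "y = 0" if "(0, y) \<in> \<Union>C" for y using that assms(2) unfolding partial_embedding_def by blast
qed

lemma Gal_Qbar_iff: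
  "\<sigma> \<in> Gal_Qbar K \<longleftrightarrow> bij_betw \<sigma> Qbar Qbar \<and> \<sigma> \<in> extensional Qbar \<and>
    (\<forall>x\<in>Qbar. \<forall>y\<in>Qbar. \<sigma> (x + y) = \<sigma> x + \<sigma> y) \<and> (\<forall>x\<in>Qbar. \<forall>y\<in>Qbar. \<sigma> (x * y) = \<sigma> x * \<sigma> y) \<and>
    \<sigma> 1 = 1 \<and> (\<forall>x\<in>K. \<sigma> x = x)"
  unfolding Gal_Qbar_def ring_iso_def ring_hom_def subfield_ring_def bij_betw_def
  by (auto simp: ring_of_type_algebra_def)

text \<open>Zorn's lemma gives a maximal graph above \<open>G0\<close>. By
  \<open>partial_embedding_extend\<close> it is defined on all of \<open>Qbar\<close>, and the same
  applied to its converse makes it surjective.\<close>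

lemma partial_embedding_automorphism:
  assumes "partial_embedding G0"
  obtains \<sigma> where "\<sigma> \<in> Gal_Qbar {}" "\<And>a b. (a, b) \<in> G0 \<Longrightarrow> \<sigma> a = b"
proof -
  let ?A = "{G. partial_embedding G \<and> G0 \<subseteq> G}"
  have "\<exists>M\<in>?A. \<forall>H\<in>?A. M \<subseteq> H \<longrightarrow> H = M"
  proof (rule subset_Zorn_nonempty)
    show "?A \<noteq> {}" using assms by blast
    fix C assume C: "C \<noteq> {}" "subset.chain ?A C"
    then have "partial_embedding (\<Union>C)"
      by (intro partial_embedding_Union) (auto simp: subset_chain_def)
    moreover have "G0 \<subseteq> \<Union>C" using C unfolding subset_chain_def by blast
    ultimately show "\<Union>C \<in> ?A" by blast
  qed
  then obtain M where "M \<in> ?A" and max: "\<forall>H\<in>?A. M \<subseteq> H \<longrightarrow> H = M" by (rule bexE)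
  then have M: "partial_embedding M" "G0 \<subseteq> M" by simp_all
  have M_max: "H = M" if "partial_embedding H" "M \<subseteq> H" for H
  proof -
    have "H \<in> ?A" using that M(2) by simp
    then show ?thesis using max that(2) by simp
  qed
  have dom: "\<exists>y. (x, y) \<in> M" if "x \<in> Qbar" for x
    using partial_embedding_extend[OF M(1) that] M_max by blast
  have ran: "\<exists>x. (x, y) \<in> M" if y: "y \<in> Qbar" for y
  proof -
    obtain x G' where G': "partial_embedding G'" "(M\<inverse>) \<subseteq> G'" "(y, x) \<in> G'"
      using partial_embedding_extend[OF partial_embedding_converse[OF M(1)] y] by blast
    then have "M \<subseteq> (G'\<inverse>)" by auto
    with G' show ?thesis using M_max[OF partial_embedding_converse[OF G'(1)]] by blast
  qed
  \<comment> \<open>By additivity, uniqueness of images and of preimages reduces to the behaviour at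
    0.\<close>
  have uni: "b = b'" if "(a, b) \<in> M" "(a, b') \<in> M" for a b b'
    using partial_embedding_zeroD[OF M(1), of "b - b'"] partial_embedding_diff[OF M(1) that] by simp
  have inj: "a = a'" if "(a, b) \<in> M" "(a', b) \<in> M" for a a' b
    using partial_embedding_inj_zero[OF M(1), of "a - a'"] partial_embedding_diff[OF M(1) that] by simp
  define \<sigma> where "\<sigma> = restrict (\<lambda>x. THE y. (x, y) \<in> M) Qbar"
  have s: "\<sigma> a = b" if "(a, b) \<in> M" for a b
    using that uni partial_embedding_Qbar[OF M(1) that] by (auto simp: \<sigma>_def intro!: the_equality)
  have s': "(a, \<sigma> a) \<in> M" if "a \<in> Qbar" for a using dom[OF that] s by auto
  have "bij_betw \<sigma> Qbar Qbar"
    unfolding bij_betw_def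
  proof
    show "inj_on \<sigma> Qbar" using s' inj by (metis inj_onI)
    show "\<sigma> ` Qbar = Qbar"
    proof
      show "\<sigma> ` Qbar \<subseteq> Qbar" using s' partial_embedding_Qbar[OF M(1)] by auto
      show "Qbar \<subseteq> \<sigma> ` Qbar"
      proof
        fix y assume "y \<in> Qbar"
        then obtain x where x: "(x, y) \<in> M" using ran by blast
        then show "y \<in> \<sigma> ` Qbar" using s[OF x] partial_embedding_Qbar[OF M(1) x] by auto
      qed
    qed
  qed
  moreover have "\<sigma> (x + y) = \<sigma> x + \<sigma> y" "\<sigma> (x * y) = \<sigma> x * \<sigma> y" if "x \<in> Qbar" "y \<in> Qbar" for x y
    using s s' that partial_embedding_add[OF M(1)] partial_embedding_mult[OF M(1)] by auto
  moreover have "\<sigma> 1 = 1" using s partial_embedding_one[OF M(1)] by blast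
  moreover have "\<sigma> \<in> extensional Qbar" by (simp add: \<sigma>_def)
  ultimately have "\<sigma> \<in> Gal_Qbar {}" by (auto simp: Gal_Qbar_iff)
  then show ?thesis using that s M(2) by blast
qed

text \<open>The map f(\<alpha>) -> f(\<beta>) on \<int>[\<alpha>] is a partial embedding and extends
  to \<open>Qbar\<close>.\<close>

lemma Gal_Qbar_transitive:
  assumes "algebraic \<alpha>" "\<beta> \<in> conjugates \<alpha>"
  obtains \<sigma> where "\<sigma> \<in> Gal_Qbar {}" "\<sigma> \<alpha> = \<beta>"
proof -
  define ev where "ev f z = poly (poly_of_int f) z" for f z
  define G where "G = range (\<lambda>f. (ev f \<alpha>, ev f \<beta>))"
  have Q: "\<alpha> \<in> Qbar" "\<beta> \<in> Qbar" using assms conjugate_algebraic by (auto simp: Qbar_def)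
  have int: "of_int i \<in> Qbar" for i by (simp add: Qbar_def)
  have evQ: "ev f z \<in> Qbar" if "z \<in> Qbar" for f z
    by (induction f) (use that Qbar_closed int in \<open>auto simp: ev_def map_poly_pCons\<close>)
  have ev_diff: "ev (f - g) z = ev f z - ev g z" and ev_mult: "ev (f * g) z = ev f z * ev g z" for f g z
    by (simp_all add: ev_def poly_of_int_diff poly_of_int_mult)
  have GI: "(ev f \<alpha>, ev f \<beta>) \<in> G" for f by (auto simp: G_def)
  have "partial_embedding G"
    unfolding partial_embedding_def
  proof (intro conjI allI impI)
    show "G \<subseteq> Qbar \<times> Qbar" using evQ Q by (auto simp: G_def)
    show "(1, 1) \<in> G" using GI[of 1] by (simp add: ev_def)
    fix a b c d assume "(a, b) \<in> G" "(c, d) \<in> G"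
    then obtain f g where fg: "a = ev f \<alpha>" "b = ev f \<beta>" "c = ev g \<alpha>" "d = ev g \<beta>" by (auto simp: G_def)
    show "(a - c, b - d) \<in> G" unfolding fg ev_diff[symmetric] by (rule GI)
    show "(a * c, b * d) \<in> G" unfolding fg ev_mult[symmetric] by (rule GI)
  next
    fix y assume "(0, y) \<in> G"
    then obtain f where "ev f \<alpha> = 0" "y = ev f \<beta>" by (auto simp: G_def)
    then show "y = 0" using conjugate_vanish[OF assms] by (simp add: ev_def)
  qed
  then obtain \<sigma> where "\<sigma> \<in> Gal_Qbar {}" "\<And>a b. (a, b) \<in> G \<Longrightarrow> \<sigma> a = b"
    by (rule partial_embedding_automorphism) blast
  moreover have "(\<alpha>, \<beta>) \<in> G" using GI[of "[:0, 1:]"] by (simp add: ev_def map_poly_pCons)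
  ultimately show ?thesis using that by blast
qed

subsection \<open>Automorphisms and the height\<close>

text \<open>Leaves codomain and extensionality open, so that embeddings of \<rat>(\<alpha>),
  automorphisms of \<open>Qbar\<close> and the identity can be treated alike.\<close>

definition hom_on :: "complex set \<Rightarrow> (complex \<Rightarrow> complex) \<Rightarrow> bool"
  where "hom_on K \<sigma> \<longleftrightarrow> (\<forall>x\<in>K. \<forall>y\<in>K. \<sigma> (x + y) = \<sigma> x + \<sigma> y \<and> \<sigma> (x * y) = \<sigma> x * \<sigma> y) \<and> \<sigma> 1 = 1"

context
  fixes K \<sigma> assumes K: "subfield K Cfield" and hom: "hom_on K \<sigma>"
begin

lemma hom_on_1: "\<sigma> 1 = 1"
  and hom_on_add: "x \<in> K \<Longrightarrow> y \<in> K \<Longrightarrow> \<sigma> (x + y) = \<sigma> x + \<sigma> y"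
  and hom_on_mult: "x \<in> K \<Longrightarrow> y \<in> K \<Longrightarrow> \<sigma> (x * y) = \<sigma> x * \<sigma> y"
  using hom by (auto simp: hom_on_def)

lemma hom_on_0: "\<sigma> 0 = 0"
  using hom_on_add[of 0 0] subfield_CfieldD(1)[OF K] by simp

lemma hom_on_diff:
  assumes "x \<in> K" "y \<in> K"
  shows "\<sigma> (x - y) = \<sigma> x - \<sigma> y"
  using hom_on_add[of "x - y" y] assms subfield_CfieldD(5)[OF K] by simp

lemma hom_on_inverse:
  assumes "x \<in> K"
  shows "\<sigma> (inverse x) = inverse (\<sigma> x)"
proof (cases "x = 0")
  case False
  then have "\<sigma> x * \<sigma> (inverse x) = 1"
    using hom_on_mult[of x "inverse x"] assms subfield_CfieldD(7)[OF K] hom_on_1 by simp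
  then show ?thesis by (metis inverse_unique)
qed (simp add: hom_on_0)

lemma hom_on_power:
  assumes "x \<in> K"
  shows "\<sigma> (x ^ n) = \<sigma> x ^ n"
proof -
  have "x ^ n \<in> K \<and> \<sigma> (x ^ n) = \<sigma> x ^ n"
    by (induction n) (use assms hom_on_mult hom_on_1 subfield_CfieldD[OF K] in auto)
  then show ?thesis ..
qed

lemma hom_on_Rats: "r \<in> \<rat> \<Longrightarrow> \<sigma> r = r"
proof -
  note K' = subfield_CfieldD[OF K]
  have QK: "\<rat> \<subseteq> K" by (rule Rats_subset_subfield[OF K])
  have n: "\<sigma> (of_nat n) = of_nat n" for n
  proof (induction n)
    case (Suc n)
    have "(of_nat n :: complex) \<in> K" using QK by auto
    then show ?case using Suc hom_on_add[of 1 "of_nat n"] hom_on_1 K'(2) by simp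
  qed (simp add: hom_on_0)
  have i: "\<sigma> (of_int i) = of_int i" for i
  proof -
    obtain a b where "i = int a - int b" by (metis int_diff_cases)
    moreover have "(of_nat a :: complex) \<in> K" "(of_nat b :: complex) \<in> K" using QK by auto
    ultimately show ?thesis using hom_on_diff[of "of_nat a" "of_nat b"] n by simp
  qed
  assume "r \<in> \<rat>"
  then obtain a b :: int where r: "r = of_int a * inverse (of_int b)"
    by (elim Rats_cases') (auto simp: divide_inverse)
  have "(of_int a :: complex) \<in> K" "(of_int b :: complex) \<in> K" using QK by auto
  then show ?thesis using hom_on_mult hom_on_inverse i K'(7) by (simp add: r)
qed

lemma hom_on_poly:
  assumes "\<And>i. Polynomial.coeff p i \<in> \<rat>" "x \<in> K"
  shows "\<sigma> (poly p x) = poly p (\<sigma> x)"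
proof -
  note K' = subfield_CfieldD[OF K]
  have QK: "\<rat> \<subseteq> K" by (rule Rats_subset_subfield[OF K])
  have "poly p x \<in> K \<and> \<sigma> (poly p x) = poly p (\<sigma> x)"
    using assms(1)
  proof (induction p)
    case (pCons c p)
    have c: "c \<in> \<rat>" using pCons.prems[of 0] by simp
    have "Polynomial.coeff p i \<in> \<rat>" for i using pCons.prems[of "Suc i"] by simp
    then have IH: "poly p x \<in> K" "\<sigma> (poly p x) = poly p (\<sigma> x)" using pCons.IH by blast+
    have "c \<in> K" "x * poly p x \<in> K" using c QK IH(1) assms(2) K'(6) by auto
    then show ?case
      using hom_on_add[of c "x * poly p x"] hom_on_mult[OF assms(2) IH(1)] hom_on_Rats[OF c] IH K'(3) by simp
  qed (simp add: hom_on_0 K')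
  then show ?thesis ..
qed

lemma hom_on_conjugate:
  assumes "x \<in> K" "algebraic x"
  shows "\<sigma> x \<in> conjugates x"
  using hom_on_poly[of "poly_of_int (min_int_poly x)" x] min_int_poly_root[OF assms(2)] assms(1)
  by (simp add: conjugates_def coeff_map_poly hom_on_0)

end

text \<open>The elements of \<open>K\<close> on which the two maps coincide form a subfield, and it
  contains \<open>S\<close>.\<close>

lemma hom_on_agree:
  assumes K: "subfield K Cfield" and s: "hom_on K \<sigma>" and t: "hom_on K \<tau>"
    and "S \<subseteq> K" "\<And>x. x \<in> S \<Longrightarrow> \<sigma> x = \<tau> x" "x \<in> adjoin S"
  shows "\<sigma> x = \<tau> x"
proof -
  have "subfield {x \<in> K. \<sigma> x = \<tau> x} Cfield"
    by (rule subfield_CfieldI)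
       (use K s t in \<open>auto simp: subfield_CfieldD hom_on_1[OF K] hom_on_diff[OF K] hom_on_mult[OF K] hom_on_inverse[OF K]\<close>)
  then have "adjoin S \<subseteq> {x \<in> K. \<sigma> x = \<tau> x}"
    by (rule adjoin_subset) (use assms in auto)
  then show ?thesis using assms by auto
qed

lemma Gal_Qbar_hom: "\<sigma> \<in> Gal_Qbar K \<Longrightarrow> hom_on Qbar \<sigma>"
  by (simp add: Gal_Qbar_iff hom_on_def)

lemma Gal_Qbar_closed: "\<sigma> \<in> Gal_Qbar K \<Longrightarrow> x \<in> Qbar \<Longrightarrow> \<sigma> x \<in> Qbar"
  by (auto simp: Gal_Qbar_iff bij_betw_def)

lemma Gal_Qbar_inj: "\<sigma> \<in> Gal_Qbar K \<Longrightarrow> inj_on \<sigma> Qbar"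
  by (auto simp: Gal_Qbar_iff bij_betw_def)

lemma Gal_Qbar_mono: "K \<subseteq> L \<Longrightarrow> Gal_Qbar L \<subseteq> Gal_Qbar K"
  unfolding Gal_Qbar_def by blast

lemma Gal_Qbar_conjugate: "\<sigma> \<in> Gal_Qbar K \<Longrightarrow> algebraic x \<Longrightarrow> \<sigma> x \<in> conjugates x"
  using hom_on_conjugate[OF subfield_Qbar Gal_Qbar_hom] by (simp add: Qbar_def)

lemma Gal_Qbar_id: "K \<subseteq> Qbar \<Longrightarrow> restrict (\<lambda>x. x) Qbar \<in> Gal_Qbar K"
  using Qbar_closed by (auto simp: Gal_Qbar_iff bij_betw_def inj_on_def)

lemma Gal_Qbar_compose:
  assumes "\<sigma> \<in> Gal_Qbar K" "\<tau> \<in> Gal_Qbar K" "K \<subseteq> Qbar"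
  shows "compose Qbar \<sigma> \<tau> \<in> Gal_Qbar K"
proof -
  have "bij_betw (compose Qbar \<sigma> \<tau>) Qbar Qbar"
    using assms by (intro bij_betw_compose) (auto simp: Gal_Qbar_iff)
  then show ?thesis
    using assms Qbar_closed Gal_Qbar_closed[OF assms(2)] unfolding Gal_Qbar_iff
    by (auto simp: compose_eq subset_iff)
qed

lemma Gal_Qbar_inverse:
  assumes s: "\<sigma> \<in> Gal_Qbar K" and KQ: "K \<subseteq> Qbar"
  obtains \<tau> where "\<tau> \<in> Gal_Qbar K" "\<And>x. x \<in> Qbar \<Longrightarrow> \<tau> (\<sigma> x) = x" "\<And>x. x \<in> Qbar \<Longrightarrow> \<sigma> (\<tau> x) = x"
proof -
  define \<tau> where "\<tau> = restrict (inv_into Qbar \<sigma>) Qbar"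
  have bij: "bij_betw \<sigma> Qbar Qbar" using s by (simp add: Gal_Qbar_iff)
  have bt: "bij_betw \<tau> Qbar Qbar"
    using bij_betw_inv_into[OF bij] by (simp add: \<tau>_def)
  then have tQ: "\<tau> x \<in> Qbar" if "x \<in> Qbar" for x using that by (auto simp: bij_betw_def)
  have ts: "\<tau> (\<sigma> x) = x" if "x \<in> Qbar" for x
    using that bij_betw_inv_into_left[OF bij that] Gal_Qbar_closed[OF s that] by (simp add: \<tau>_def)
  have st: "\<sigma> (\<tau> x) = x" if "x \<in> Qbar" for x
    using that bij_betw_inv_into_right[OF bij that] by (simp add: \<tau>_def)
  \<comment> \<open>Identities for \<tau> are checked after applying \<sigma>, where they become
    identities for \<sigma>.\<close>
  have eqI: "x = y" if "x \<in> Qbar" "y \<in> Qbar" "\<sigma> x = \<sigma> y" for x y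
    using ts that by metis
  note hom = hom_on_add[OF subfield_Qbar Gal_Qbar_hom[OF s]] hom_on_mult[OF subfield_Qbar Gal_Qbar_hom[OF s]]
  have "\<tau> \<in> Gal_Qbar K"
    unfolding Gal_Qbar_iff
  proof (intro conjI ballI)
    show "\<tau> \<in> extensional Qbar" by (simp add: \<tau>_def)
    show "\<tau> (x + y) = \<tau> x + \<tau> y" "\<tau> (x * y) = \<tau> x * \<tau> y" if "x \<in> Qbar" "y \<in> Qbar" for x y
      by (rule eqI; use that Qbar_closed tQ st hom in simp)+
    show "\<tau> 1 = 1" using ts[of 1] s Qbar_closed by (simp add: Gal_Qbar_iff)
    show "\<tau> x = x" if "x \<in> K" for x using ts[of x] s that KQ by (auto simp: Gal_Qbar_iff)
  qed (rule bt)
  then show ?thesis using that ts st by blast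
qed

text \<open>Allows each Galois group below to be taken over a set of generators: over \<Gamma> in
  place of \<rat>(\<Gamma>), over \<open>{}\<close> in place of \<rat>.\<close>

lemma Gal_Qbar_adjoin:
  assumes "S \<subseteq> Qbar"
  shows "Gal_Qbar (adjoin S) = Gal_Qbar S"
proof
  show "Gal_Qbar (adjoin S) \<subseteq> Gal_Qbar S" by (rule Gal_Qbar_mono[OF subset_adjoin])
  show "Gal_Qbar S \<subseteq> Gal_Qbar (adjoin S)"
  proof
    fix \<sigma> assume s: "\<sigma> \<in> Gal_Qbar S"
    have "\<sigma> x = x" if "x \<in> adjoin S" for x
      by (rule hom_on_agree[OF subfield_Qbar Gal_Qbar_hom[OF s] _ assms _ that, of "\<lambda>x. x"])
         (use s in \<open>auto simp: hom_on_def Gal_Qbar_iff\<close>)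
    then show "\<sigma> \<in> Gal_Qbar (adjoin S)" using s by (simp add: Gal_Qbar_iff)
  qed
qed

text \<open>The algebraic numbers that \<sigma> sends into \<open>adjoin T\<close> form a
  subfield.\<close>

lemma Gal_Qbar_adjoin_image:
  assumes s: "\<sigma> \<in> Gal_Qbar K" and S: "S \<subseteq> Qbar" and im: "\<And>x. x \<in> S \<Longrightarrow> \<sigma> x \<in> adjoin T" and x: "x \<in> adjoin S"
  shows "\<sigma> x \<in> adjoin T"
proof -
  note h = Gal_Qbar_hom[OF s]
  note T = subfield_CfieldD[OF subfield_adjoin[of T]]
  have "subfield {x \<in> Qbar. \<sigma> x \<in> adjoin T} Cfield"
    by (rule subfield_CfieldI)
       (use Qbar_closed T in \<open>auto simp: hom_on_1[OF subfield_Qbar h] hom_on_diff[OF subfield_Qbar h]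
          hom_on_mult[OF subfield_Qbar h] hom_on_inverse[OF subfield_Qbar h]\<close>)
  then have "adjoin S \<subseteq> {x \<in> Qbar. \<sigma> x \<in> adjoin T}"
    by (rule adjoin_subset) (use S im in auto)
  then show ?thesis using x by auto
qed

section \<open>Degree, embeddings and height in terms of conjugates\<close>

text \<open>The irreducible polynomial over \<rat> divides the integral minimal polynomial, which
  bounds the degree above by the number of conjugates. Conversely automorphisms carry its root
  \<alpha> to every conjugate, so its degree is at least their number.\<close>

lemma degree_over_Q_eq:
  assumes alg: "algebraic \<alpha>"
  shows "degree_over_Q \<alpha> = card (conjugates \<alpha>)"
proof -
  let ?I = "Cfield.Irr \<rat> \<alpha>" and ?E = "Cfield.simple_extension \<rat> \<alpha>"
  note Q = subfield_Rats
  have a: "(Cfield.algebraic over \<rat>) \<alpha>" using alg by (simp add: algebraic_over_Rats_iff)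
  have car: "\<alpha> \<in> carrier Cfield" by simp
  have E: "subfield ?E Cfield" using Cfield.simple_extension_is_subfield[OF Q car] a by blast
  have "adjoin {\<alpha>} = ?E"
  proof
    show "adjoin {\<alpha>} \<subseteq> ?E"
      using Cfield.simple_extension_mem[OF subfieldE(1)[OF Q] car] by (intro adjoin_subset E) simp
    show "?E \<subseteq> adjoin {\<alpha>}"
      using subset_adjoin[of "{\<alpha>}"] Rats_subset_subfield[OF subfield_adjoin]
      by (intro Cfield.simple_extension_subring_incl subfieldE(1)[OF subfield_adjoin]) auto
  qed
  \<comment> \<open>A coefficient list is one longer than the degree.\<close>
  then have D: "degree_over_Q \<alpha> = length ?I - 1"
    using Cfield.simple_extension_dim[OF Q car a] by (simp add: degree_over_Q_def over_def)
  note I = Cfield.IrrE[OF Q car a]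
  have I0: "?I \<noteq> []" by (rule Cfield.pirreducibleE(1)[OF subfieldE(1)[OF Q] I(1,2)])
  let ?p = "poly_of_int (min_int_poly \<alpha>)"
  have p0: "?p \<noteq> 0" using min_int_poly_nonzero[OF alg] by simp
  have p: "rev (coeffs ?p) \<in> carrier (\<rat> [X]\<^bsub>Cfield\<^esub>)"
    by (rule rat_poly_in_univ_poly) (use p0 in \<open>simp_all add: coeff_map_poly\<close>)
  have "?I pdivides\<^bsub>Cfield\<^esub> rev (coeffs ?p)"
    using min_int_poly_root[OF alg] by (intro Cfield.Irr_minimal[OF Q car a p]) (simp add: eval_Cfield)
  then have "length ?I - 1 \<le> length (rev (coeffs ?p)) - 1"
    using p0 by (intro Cfield.pdivides_imp_degree_le[OF subfieldE(1)[OF Q] I(1) p]) simp_all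
  then have "length ?I - 1 \<le> card (conjugates \<alpha>)"
    using p0 by (simp add: length_coeffs_degree degree_min_int_poly[OF alg])
  moreover have "card (conjugates \<alpha>) \<le> length ?I - 1"
  proof -
    let ?q = "Poly (rev ?I)"
    note q = univ_poly_rat_poly[OF I(1) I0]
    have q0: "poly ?q \<alpha> = 0" using I(4) by (simp add: eval_Cfield)
    have "conjugates \<alpha> \<subseteq> {x. poly ?q x = 0}"
    proof
      fix \<beta> assume "\<beta> \<in> conjugates \<alpha>"
      then obtain \<sigma> where s: "\<sigma> \<in> Gal_Qbar {}" "\<sigma> \<alpha> = \<beta>" using Gal_Qbar_transitive[OF alg] by blast
      note h = Gal_Qbar_hom[OF s(1)]
      have "\<sigma> (poly ?q \<alpha>) = poly ?q \<beta>"
        using hom_on_poly[OF subfield_Qbar h, of ?q \<alpha>] q(2) alg s(2) by (simp add: Qbar_def)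
      then show "\<beta> \<in> {x. poly ?q x = 0}" using q0 hom_on_0[OF subfield_Qbar h] by simp
    qed
    then have "card (conjugates \<alpha>) \<le> card {x. poly ?q x = 0}"
      using poly_roots_finite[OF q(1)] by (rule card_mono[rotated])
    also have "\<dots> \<le> Polynomial.degree ?q" by (rule card_poly_roots_bound[OF q(1)])
    finally show ?thesis using q(3) by simp
  qed
  ultimately show ?thesis using D by simp
qed

text \<open>Injective because \<alpha> generates the field; surjective because an automorphism
  taking \<alpha> to a given conjugate restricts to an embedding.\<close>

lemma bij_betw_embeddings:
  assumes alg: "algebraic \<alpha>"
  shows "bij_betw (\<lambda>\<sigma>. \<sigma> \<alpha>) (embeddings (adjoin {\<alpha>})) (conjugates \<alpha>)"
  unfolding bij_betw_def
proof
  let ?K = "adjoin {\<alpha>}"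
  note K = subfield_adjoin[of "{\<alpha>}"]
  have aK: "\<alpha> \<in> ?K" using subset_adjoin by blast
  have KQ: "?K \<subseteq> Qbar" using alg by (intro adjoin_subset subfield_Qbar) (simp add: Qbar_def)
  have emb: "\<sigma> \<in> embeddings ?K \<longleftrightarrow> hom_on ?K \<sigma> \<and> \<sigma> ` ?K \<subseteq> Qbar \<and> \<sigma> \<in> extensional ?K" for \<sigma>
    by (auto simp: embeddings_def ring_hom_def subfield_ring_def hom_on_def ring_of_type_algebra_def)
  show "inj_on (\<lambda>\<sigma>. \<sigma> \<alpha>) (embeddings ?K)"
  proof
    fix \<sigma> \<tau> assume *: "\<sigma> \<in> embeddings ?K" "\<tau> \<in> embeddings ?K" "\<sigma> \<alpha> = \<tau> \<alpha>"
    show "\<sigma> = \<tau>"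
    proof (rule extensionalityI[of _ ?K])
      show "\<sigma> x = \<tau> x" if "x \<in> ?K" for x
        by (rule hom_on_agree[OF K _ _ _ _ that]) (use * emb aK in auto)
    qed (use * emb in auto)
  qed
  show "(\<lambda>\<sigma>. \<sigma> \<alpha>) ` embeddings ?K = conjugates \<alpha>"
  proof safe
    show "\<sigma> \<alpha> \<in> conjugates \<alpha>" if "\<sigma> \<in> embeddings ?K" for \<sigma>
      using hom_on_conjugate[OF K _ aK alg] that emb by blast
    fix \<beta> assume "\<beta> \<in> conjugates \<alpha>"
    then obtain \<sigma> where s: "\<sigma> \<in> Gal_Qbar {}" "\<sigma> \<alpha> = \<beta>" using Gal_Qbar_transitive[OF alg] by blast
    have "hom_on ?K (restrict \<sigma> ?K)"
      using Gal_Qbar_hom[OF s(1)] KQ subfield_CfieldD[OF K] by (auto simp: hom_on_def subset_iff)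
    then have "restrict \<sigma> ?K \<in> embeddings ?K"
      unfolding emb using Gal_Qbar_closed[OF s(1)] KQ by auto
    moreover have "\<beta> = restrict \<sigma> ?K \<alpha>" using s(2) aK by simp
    ultimately show "\<beta> \<in> (\<lambda>\<sigma>. \<sigma> \<alpha>) ` embeddings ?K" by blast
  qed
qed

lemma weil_height_eq:
  assumes "algebraic \<alpha>"
  shows "weil_height \<alpha> = ln (real_of_int \<bar>lc \<alpha>\<bar> * (\<Prod>z\<in>conjugates \<alpha>. max 1 (cmod z))) / card (conjugates \<alpha>)"
  using prod.reindex_bij_betw[OF bij_betw_embeddings[OF assms], of "\<lambda>z. max 1 (cmod z)"]
  by (simp add: weil_height_def degree_over_Q_eq[OF assms])

lemma weil_height_nonneg:
  assumes "algebraic \<alpha>"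
  shows "weil_height \<alpha> \<ge> 0"
proof -
  have "lc \<alpha> \<ge> 1" using min_int_poly_lc_pos[OF assms] by (simp add: lc_def)
  then have "1 \<le> real_of_int \<bar>lc \<alpha>\<bar>" by simp
  moreover have "1 \<le> (\<Prod>z\<in>conjugates \<alpha>. max 1 (cmod z))" by (rule prod_ge_1) simp
  ultimately have "1 * 1 \<le> real_of_int \<bar>lc \<alpha>\<bar> * (\<Prod>z\<in>conjugates \<alpha>. max 1 (cmod z))"
    by (intro mult_mono) auto
  then show ?thesis by (simp add: weil_height_eq[OF assms] ln_ge_zero)
qed

lemma weil_height_conjugate:
  assumes "algebraic \<alpha>" "\<beta> \<in> conjugates \<alpha>"
  shows "weil_height \<beta> = weil_height \<alpha>"
  using assms conjugate_algebraic[OF assms] min_int_poly_conjugate[OF assms]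
  by (simp add: weil_height_eq conjugates_def lc_def)

lemma sum_abs_ln_le_weil_height:
  assumes "algebraic \<alpha>" "\<alpha> \<noteq> 0"
  shows "(\<Sum>z\<in>conjugates \<alpha>. \<bar>ln (cmod z)\<bar>) \<le> 2 * weil_height \<alpha> * card (conjugates \<alpha>)"
proof -
  have "card (conjugates \<alpha>) > 0"
    using finite_conjugates[OF assms(1)] conjugate_self[OF assms(1)] by (auto simp: card_gt_0_iff)
  then show ?thesis
    using sum_abs_ln_conjugates_le[OF assms] by (simp add: weil_height_eq[OF assms(1)])
qed

subsection \<open>Galois orbits and means\<close>

text \<open>For \<open>K\<close> inside \<open>Qbar\<close> this is the orbit over the field
  \<open>adjoin K\<close>, by \<open>Gal_Qbar_adjoin\<close>.\<close>

definition Gal_orbit :: "complex set \<Rightarrow> complex \<Rightarrow> complex set"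
  where "Gal_orbit K \<alpha> = (\<lambda>\<sigma>. \<sigma> \<alpha>) ` Gal_Qbar K"

lemma Gal_orbitI: "\<sigma> \<in> Gal_Qbar K \<Longrightarrow> \<sigma> \<alpha> \<in> Gal_orbit K \<alpha>"
  by (simp add: Gal_orbit_def)

lemma Gal_orbit_Qbar: "\<alpha> \<in> Qbar \<Longrightarrow> Gal_orbit K \<alpha> \<subseteq> Qbar"
  using Gal_Qbar_closed by (auto simp: Gal_orbit_def)

lemma Gal_orbit_conjugates: "\<alpha> \<in> Qbar \<Longrightarrow> Gal_orbit K \<alpha> \<subseteq> conjugates \<alpha>"
  using Gal_Qbar_conjugate by (auto simp: Gal_orbit_def Qbar_def)

lemma finite_Gal_orbit: "\<alpha> \<in> Qbar \<Longrightarrow> finite (Gal_orbit K \<alpha>)"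
  using finite_subset[OF Gal_orbit_conjugates finite_conjugates] by (simp add: Qbar_def)

lemma Gal_orbit_mono: "K \<subseteq> L \<Longrightarrow> Gal_orbit L \<alpha> \<subseteq> Gal_orbit K \<alpha>"
  unfolding Gal_orbit_def by (intro image_mono Gal_Qbar_mono)

lemma conjugates_eq_Gal_orbit:
  assumes "\<alpha> \<in> Qbar"
  shows "conjugates \<alpha> = Gal_orbit {} \<alpha>"
proof (rule antisym)
  show "conjugates \<alpha> \<subseteq> Gal_orbit {} \<alpha>"
  proof
    fix \<beta> assume "\<beta> \<in> conjugates \<alpha>"
    then obtain \<sigma> where "\<sigma> \<in> Gal_Qbar {}" "\<sigma> \<alpha> = \<beta>"
      using Gal_Qbar_transitive[of \<alpha> \<beta>] assms by (auto simp: Qbar_def)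
    then show "\<beta> \<in> Gal_orbit {} \<alpha>" using Gal_orbitI by blast
  qed
qed (rule Gal_orbit_conjugates[OF assms])

context
  fixes K assumes K: "K \<subseteq> Qbar"
begin

lemma Gal_orbit_self: "\<alpha> \<in> Qbar \<Longrightarrow> \<alpha> \<in> Gal_orbit K \<alpha>"
  using Gal_orbitI[OF Gal_Qbar_id[OF K], of \<alpha>] by simp

lemma Gal_orbit_trans:
  assumes "\<alpha> \<in> Qbar" "\<beta> \<in> Gal_orbit K \<alpha>" "\<gamma> \<in> Gal_orbit K \<beta>"
  shows "\<gamma> \<in> Gal_orbit K \<alpha>"
proof -
  obtain \<sigma> \<tau> where s: "\<sigma> \<in> Gal_Qbar K" "\<tau> \<in> Gal_Qbar K" "\<beta> = \<sigma> \<alpha>" "\<gamma> = \<tau> \<beta>"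
    using assms by (auto simp: Gal_orbit_def)
  then show ?thesis
    using Gal_orbitI[OF Gal_Qbar_compose[OF s(2,1) K], of \<alpha>] assms(1) by (simp add: compose_eq)
qed

lemma Gal_orbit_sym:
  assumes "\<alpha> \<in> Qbar" "\<beta> \<in> Gal_orbit K \<alpha>"
  shows "\<alpha> \<in> Gal_orbit K \<beta>"
proof -
  obtain \<sigma> where s: "\<sigma> \<in> Gal_Qbar K" "\<beta> = \<sigma> \<alpha>" using assms by (auto simp: Gal_orbit_def)
  then show ?thesis
    using Gal_Qbar_inverse[OF s(1) K] Gal_orbitI assms(1) by metis
qed

end

text \<open>\<open>C\<close> counts the candidates for the restriction of an automorphism to \<open>S\<close>; automorphisms with
  the same restriction form a coset of the stabilizer of \<open>S\<close>.\<close>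

lemma card_conjugates_le_Gal_orbit:
  assumes S: "finite S" "S \<subseteq> Qbar"
  obtains C :: nat where "\<And>\<alpha>. \<alpha> \<in> Qbar \<Longrightarrow> card (conjugates \<alpha>) \<le> C * card (Gal_orbit S \<alpha>)"
proof
  let ?P = "Pi\<^sub>E S conjugates" and ?r = "\<lambda>\<sigma>. restrict \<sigma> S"
  have finP: "finite ?P"
    using S finite_conjugates by (intro finite_PiE) (auto simp: Qbar_def)
  fix \<alpha> assume a: "\<alpha> \<in> Qbar"
  define R where "R = ?r ` Gal_Qbar {}"
  \<comment> \<open>\<open>F t\<close> collects the images of \<alpha> under one coset, the
    automorphisms restricting to \<open>t\<close> on \<open>S\<close>.\<close>
  define F where "F t = (\<lambda>\<sigma>. \<sigma> \<alpha>) ` {\<sigma> \<in> Gal_Qbar {}. ?r \<sigma> = t}" for t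
  have RP: "R \<subseteq> ?P"
    using S(2) Gal_Qbar_conjugate by (auto simp: R_def Qbar_def PiE_iff)
  have F: "card (F t) \<le> card (Gal_orbit S \<alpha>)" if "t \<in> R" for t
  proof -
    obtain \<rho> where r: "\<rho> \<in> Gal_Qbar {}" "t = ?r \<rho>" using \<open>t \<in> R\<close> by (auto simp: R_def)
    obtain \<tau> where t: "\<tau> \<in> Gal_Qbar {}" "\<And>x. x \<in> Qbar \<Longrightarrow> \<tau> (\<rho> x) = x" "\<And>x. x \<in> Qbar \<Longrightarrow> \<rho> (\<tau> x) = x"
      using Gal_Qbar_inverse[OF r(1)] by blast
    \<comment> \<open>If \<sigma> and \<rho> agree on \<open>S\<close>, then \<tau> \<sigma> fixes
      \<open>S\<close>, where \<tau> inverts \<rho>; so \<sigma> \<alpha> lies in the \<rho>-image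
      of the orbit.\<close>
    have "F t \<subseteq> \<rho> ` Gal_orbit S \<alpha>"
    proof
      fix x assume "x \<in> F t"
      then obtain \<sigma> where s: "\<sigma> \<in> Gal_Qbar {}" "?r \<sigma> = ?r \<rho>" "x = \<sigma> \<alpha>" by (auto simp: F_def r)
      have eq: "\<sigma> y = \<rho> y" if "y \<in> S" for y using s(2) that by (metis restrict_apply')
      have "compose Qbar \<tau> \<sigma> \<in> Gal_Qbar {}" by (rule Gal_Qbar_compose[OF t(1) s(1)]) simp
      moreover have "compose Qbar \<tau> \<sigma> y = y" if "y \<in> S" for y
        using that eq t(2) S(2) by (auto simp: compose_eq)
      ultimately have "compose Qbar \<tau> \<sigma> \<in> Gal_Qbar S" by (simp add: Gal_Qbar_iff)
      from Gal_orbitI[OF this, of \<alpha>] have "\<tau> x \<in> Gal_orbit S \<alpha>" using a s(3) by (simp add: compose_eq)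
      moreover have "x = \<rho> (\<tau> x)" using t(3) Gal_Qbar_closed[OF s(1) a] s(3) by simp
      ultimately show "x \<in> \<rho> ` Gal_orbit S \<alpha>" by blast
    qed
    then show ?thesis using finite_Gal_orbit[OF a] by (meson card_image_le card_mono finite_imageI le_trans)
  qed
  have finR: "finite R" using RP finP by (rule finite_subset)
  have "conjugates \<alpha> = (\<Union>t\<in>R. F t)"
    using conjugates_eq_Gal_orbit[OF a] by (auto simp: Gal_orbit_def R_def F_def)
  then have "card (conjugates \<alpha>) \<le> (\<Sum>t\<in>R. card (F t))" using card_UN_le[OF finR] by simp
  also have "\<dots> \<le> card R * card (Gal_orbit S \<alpha>)" using sum_bounded_above[of R, OF F] by simp
  also have "\<dots> \<le> card ?P * card (Gal_orbit S \<alpha>)" using RP finP by (intro mult_right_mono card_mono) auto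
  finally show "card (conjugates \<alpha>) \<le> card ?P * card (Gal_orbit S \<alpha>)" .
qed

text \<open>Used to see that automorphisms fixing the generators of \<Gamma> fix all of \<Gamma>.
  Excluding 0 identifies the group inverse with the field inverse.\<close>

lemma generate_Cstar_subset_adjoin:
  assumes "0 \<notin> S"
  shows "generate Cstar S \<subseteq> adjoin S"
proof
  note A = subfield_CfieldD[OF subfield_adjoin[of S]]
  fix x assume "x \<in> generate Cstar S"
  then show "x \<in> adjoin S"
  proof induction
    case (inv h)
    then have "h \<noteq> 0" using assms by auto
    then have "inv\<^bsub>Cstar\<^esub> h = inverse h"
      by (simp add: field.m_inv_mult_of[OF field_Cfield] inv_Cfield)
    then show ?case using A(7) inv subset_adjoin by auto
  qed (use A in \<open>auto intro: generate_field.incl\<close>)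
qed

section \<open>Galois action on roots of unity, on the division group and on orbits over
  \<open>K_field \<Gamma>\<close>\<close>

lemma roots_of_unity_Qbar: "roots_of_unity \<subseteq> Qbar"
  unfolding roots_of_unity_def using Qbar_root Qbar_closed(2) by blast

lemma div_group_Qbar: "div_group \<Gamma> \<subseteq> Qbar"
  by (auto simp: div_group_def)

lemma Gal_Qbar_root_of_unity:
  assumes "\<sigma> \<in> Gal_Qbar K" "z \<in> roots_of_unity"
  shows "\<sigma> z \<in> roots_of_unity"
proof -
  obtain n where n: "n \<ge> 1" "z ^ n = 1" using assms by (auto simp: roots_of_unity_def)
  note h = Gal_Qbar_hom[OF assms(1)]
  have "\<sigma> z ^ n = 1"
    using hom_on_power[OF subfield_Qbar h, of z n] hom_on_1[OF subfield_Qbar h] n assms(2) roots_of_unity_Qbar by auto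
  then show ?thesis using n by (auto simp: roots_of_unity_def)
qed

text \<open>A power of \<open>z\<close> lying in \<Gamma> is fixed, so \<sigma> z has the same n-th
  power as \<open>z\<close>; in particular it is nonzero.\<close>

lemma Gal_Qbar_div_group:
  assumes s: "\<sigma> \<in> Gal_Qbar \<Gamma>" and z: "z \<in> div_group \<Gamma>"
  shows "\<sigma> z \<in> div_group \<Gamma>"
proof -
  obtain n where n: "n \<ge> 1" "z ^ n \<in> \<Gamma>" "z \<in> Qbar" "z \<noteq> 0" using z by (auto simp: div_group_def)
  note h = Gal_Qbar_hom[OF s]
  have "\<sigma> (z ^ n) = z ^ n" using n(2) s unfolding Gal_Qbar_iff by blast
  then have "\<sigma> z ^ n = z ^ n" by (simp add: hom_on_power[OF subfield_Qbar h n(3)])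
  then show ?thesis
    using n Gal_Qbar_closed[OF s n(3)] by (auto simp: div_group_def power_0_left intro!: exI[of _ n])
qed

context
  fixes \<Gamma> assumes \<Gamma>: "\<Gamma> \<subseteq> Qbar"
begin

lemma galois_orbit_eq: "galois_orbit \<Gamma> \<alpha> = Gal_orbit (roots_of_unity \<union> \<Gamma>) \<alpha>"
  using \<Gamma> roots_of_unity_Qbar by (simp add: galois_orbit_def Gal_orbit_def K_field_def Gal_Qbar_adjoin)

text \<open>Conjugating an element of the smaller Galois group by \<open>g\<close> stays in that group:
  \<open>\<rat>(\<mu>\<^sub>\<infinity>, \<Gamma>) / \<rat>(\<Gamma>)\<close> is a normal extension.\<close>

lemma Gal_orbit_translate:
  assumes g: "g \<in> Gal_Qbar \<Gamma>" and a: "\<alpha> \<in> Qbar"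
  shows "Gal_orbit (roots_of_unity \<union> \<Gamma>) (g \<alpha>) \<subseteq> g ` Gal_orbit (roots_of_unity \<union> \<Gamma>) \<alpha>"
proof
  obtain h where h: "h \<in> Gal_Qbar \<Gamma>" "\<And>x. x \<in> Qbar \<Longrightarrow> h (g x) = x" "\<And>x. x \<in> Qbar \<Longrightarrow> g (h x) = x"
    using Gal_Qbar_inverse[OF g \<Gamma>] by blast
  fix x assume "x \<in> Gal_orbit (roots_of_unity \<union> \<Gamma>) (g \<alpha>)"
  then obtain n where n: "n \<in> Gal_Qbar (roots_of_unity \<union> \<Gamma>)" "x = n (g \<alpha>)" by (auto simp: Gal_orbit_def)
  have n': "n \<in> Gal_Qbar \<Gamma>" using n(1) Gal_Qbar_mono[of \<Gamma> "roots_of_unity \<union> \<Gamma>"] by blast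
  \<comment> \<open>\<open>c\<close> is the conjugate of \<open>n\<close> by \<open>g\<close>. It
    fixes roots of unity because \<open>g\<close> permutes them and \<open>n\<close> fixes
    them.\<close>
  define c where "c = compose Qbar h (compose Qbar n g)"
  have c: "c y = h (n (g y))" if "y \<in> Qbar" for y using that by (simp add: c_def compose_eq)
  have "c \<in> Gal_Qbar \<Gamma>"
    unfolding c_def by (intro Gal_Qbar_compose h(1) n' g \<Gamma>)
  moreover have "c z = z" if "z \<in> roots_of_unity" for z
  proof -
    have "g z \<in> roots_of_unity" by (rule Gal_Qbar_root_of_unity[OF g that])
    then have "n (g z) = g z" using n(1) by (simp add: Gal_Qbar_iff)
    then show ?thesis using that roots_of_unity_Qbar c h(2) by auto
  qed
  ultimately have "c \<in> Gal_Qbar (roots_of_unity \<union> \<Gamma>)" by (auto simp: Gal_Qbar_iff)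
  then have "c \<alpha> \<in> Gal_orbit (roots_of_unity \<union> \<Gamma>) \<alpha>" by (rule Gal_orbitI)
  moreover have "x = g (c \<alpha>)"
    using c[OF a] n h(3) Gal_Qbar_closed[OF n(1) Gal_Qbar_closed[OF g a]] by simp
  ultimately show "x \<in> g ` Gal_orbit (roots_of_unity \<union> \<Gamma>) \<alpha>" by blast
qed

text \<open>\<open>Gal_orbit_translate\<close> gives one inequality; the other follows by exchanging
  \<alpha> and \<beta>.\<close>

lemma card_Gal_orbit_translate:
  assumes a: "\<alpha> \<in> Qbar" and b: "\<beta> \<in> Gal_orbit \<Gamma> \<alpha>"
  shows "card (Gal_orbit (roots_of_unity \<union> \<Gamma>) \<beta>) = card (Gal_orbit (roots_of_unity \<union> \<Gamma>) \<alpha>)"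
proof -
  have *: "card (Gal_orbit (roots_of_unity \<union> \<Gamma>) \<beta>) \<le> card (Gal_orbit (roots_of_unity \<union> \<Gamma>) \<alpha>)" if "\<alpha> \<in> Qbar" "\<beta> \<in> Gal_orbit \<Gamma> \<alpha>" for \<alpha> \<beta>
    using that Gal_orbit_translate finite_Gal_orbit unfolding Gal_orbit_def[of \<Gamma>]
    by (smt (verit) card_image_le card_mono finite_imageI imageE le_trans)
  have "\<beta> \<in> Qbar" using b Gal_orbit_Qbar[OF a] by blast
  then show ?thesis using *[OF a b] *[OF _ Gal_orbit_sym[OF \<Gamma> a b]] by simp
qed

text \<open>Double counting: as \<open>x\<close> runs through the large orbit \<open>A\<close>, each
  \<open>y\<close> in \<open>A\<close> lies in exactly \<open>m\<close> of the small orbits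
  \<open>N x\<close>, all of size \<open>m\<close>. So the sums over the \<open>N x\<close> add up
  to \<open>m * sum f A\<close>, and not all of them can exceed their average.\<close>

lemma exists_Gal_orbit_le_average:
  fixes f :: "complex \<Rightarrow> real"
  assumes a: "\<alpha> \<in> Qbar"
  obtains \<beta> where "\<beta> \<in> Gal_orbit \<Gamma> \<alpha>"
    "sum f (Gal_orbit (roots_of_unity \<union> \<Gamma>) \<beta>) * card (Gal_orbit \<Gamma> \<alpha>) \<le> card (Gal_orbit (roots_of_unity \<union> \<Gamma>) \<beta>) * sum f (Gal_orbit \<Gamma> \<alpha>)"
proof -
  have LQ: "(roots_of_unity \<union> \<Gamma>) \<subseteq> Qbar" using \<Gamma> roots_of_unity_Qbar by blast
  define A where "A = Gal_orbit \<Gamma> \<alpha>"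
  define N where "N = Gal_orbit (roots_of_unity \<union> \<Gamma>)"
  define m where "m = card (N \<alpha>)"
  have AQ: "A \<subseteq> Qbar" using Gal_orbit_Qbar[OF a] by (simp add: A_def)
  have finA: "finite A" using finite_Gal_orbit[OF a] by (simp add: A_def)
  have A0: "A \<noteq> {}" using Gal_orbit_self[OF \<Gamma> a] by (auto simp: A_def)
  have NA: "N x \<subseteq> A" if "x \<in> A" for x
    using that Gal_orbit_trans[OF \<Gamma> a] Gal_orbit_mono[of \<Gamma> "roots_of_unity \<union> \<Gamma>" x] by (auto simp: A_def N_def)
  have card_N: "card (N x) = m" if "x \<in> A" for x
    using that card_Gal_orbit_translate[OF a] by (simp add: N_def m_def A_def)
  have N_eq: "N x = {y \<in> A. y \<in> N x}" if "x \<in> A" for x using NA[OF that] by blast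
  have N_sym: "y \<in> N x \<longleftrightarrow> x \<in> N y" if "x \<in> A" "y \<in> A" for x y
    using Gal_orbit_sym[OF LQ] that AQ unfolding N_def by blast
  have "(\<Sum>x\<in>A. sum f (N x)) = (\<Sum>x\<in>A. \<Sum>y | y \<in> A \<and> y \<in> N x. f y)"
    using N_eq by (intro sum.cong) auto
  also have "\<dots> = (\<Sum>y\<in>A. \<Sum>x | x \<in> A \<and> y \<in> N x. f y)"
    by (rule sum.swap_restrict[OF finA finA])
  \<comment> \<open>Symmetry of the orbit relation turns the \<open>x\<close> with \<open>y\<close>
    in \<open>N x\<close> into the elements of \<open>N y\<close>.\<close>
  also have "\<dots> = (\<Sum>y\<in>A. \<Sum>x\<in>N y. f y)"
    using N_sym NA by (intro sum.cong) auto
  also have "\<dots> = (\<Sum>y\<in>A. m * f y)"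
    using card_N by (intro sum.cong) simp_all
  finally have total: "(\<Sum>x\<in>A. sum f (N x)) = m * sum f A" by (simp add: sum_distrib_left)
  have "\<exists>x\<in>A. sum f (N x) * card A \<le> m * sum f A"
  proof (rule ccontr)
    assume "\<not> ?thesis"
    then have "(\<Sum>x\<in>A. m * sum f A) < (\<Sum>x\<in>A. sum f (N x) * card A)"
      by (intro sum_strict_mono finA A0) (auto simp: not_le)
    then show False by (simp only: sum_distrib_right[symmetric] total) simp
  qed
  then show ?thesis using that card_N by (auto simp: A_def N_def)
qed

text \<open>Markov's inequality: outside the annulus | ln |z| | is at least ln(1 + \<epsilon>) /
  2.\<close>

lemma orbit_density_ge:
  fixes \<epsilon> \<eta> :: real
  assumes x: "x \<in> Qbar" "x \<noteq> 0" and e: "\<epsilon> > 0"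
    and le: "(\<Sum>z\<in>Gal_orbit (roots_of_unity \<union> \<Gamma>) x. \<bar>ln (cmod z)\<bar>) \<le> \<eta> * card (Gal_orbit (roots_of_unity \<union> \<Gamma>) x)"
  shows "1 - 2 * \<eta> / ln (1 + \<epsilon>) \<le> orbit_density \<Gamma> \<epsilon> x" "orbit_density \<Gamma> \<epsilon> x \<le> 1"
proof -
  have LQ: "(roots_of_unity \<union> \<Gamma>) \<subseteq> Qbar" using \<Gamma> roots_of_unity_Qbar by blast
  define N where "N = Gal_orbit (roots_of_unity \<union> \<Gamma>) x"
  define P where "P = {z \<in> N. 1 - \<epsilon> \<le> (cmod z)\<^sup>2 \<and> (cmod z)\<^sup>2 \<le> 1 + \<epsilon>}"
  have fin: "finite N" using finite_Gal_orbit[OF x(1)] by (simp add: N_def)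
  have N0: "card N > 0" using Gal_orbit_self[OF LQ x(1)] fin by (auto simp: N_def card_gt_0_iff)
  have P: "P \<subseteq> N" by (auto simp: P_def)
  have dens: "orbit_density \<Gamma> \<epsilon> x = card P / card N"
    by (simp add: orbit_density_def galois_orbit_eq P_def N_def)
  show "orbit_density \<Gamma> \<epsilon> x \<le> 1"
    using card_mono[OF fin P] N0 by (simp add: dens)
  define l where "l = ln (1 + \<epsilon>)"
  have l: "l > 0" "l \<le> \<epsilon>" using e ln_add_one_self_le_self[of \<epsilon>] by (auto simp: l_def)
  have nz: "z \<noteq> 0" if "z \<in> N" for z
  proof
    assume "z = 0"
    then have "0 \<in> (\<lambda>\<sigma>. \<sigma> x) ` Gal_Qbar (roots_of_unity \<union> \<Gamma>)" using that by (simp add: N_def Gal_orbit_def)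
    then obtain \<sigma> where s: "\<sigma> \<in> Gal_Qbar (roots_of_unity \<union> \<Gamma>)" "0 = \<sigma> x" by blast
    have "\<sigma> x = \<sigma> 0" using hom_on_0[OF subfield_Qbar Gal_Qbar_hom[OF s(1)]] s(2) by simp
    then have "x = 0" by (rule inj_onD[OF Gal_Qbar_inj[OF s(1)]]) (use x Qbar_closed(1) in auto)
    then show False using x(2) by simp
  qed
  have bad: "l \<le> 2 * \<bar>ln (cmod z)\<bar>" if zN: "z \<in> N - P" for z
  proof -
    have z: "cmod z > 0" using zN nz by auto
    have sq: "ln ((cmod z)\<^sup>2) = 2 * ln (cmod z)" using z by (simp add: ln_realpow)
    consider "(cmod z)\<^sup>2 > 1 + \<epsilon>" | "(cmod z)\<^sup>2 < 1 - \<epsilon>" using zN by (force simp: P_def)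
    then show ?thesis
    proof cases
      case 1
      then have "ln (1 + \<epsilon>) \<le> ln ((cmod z)\<^sup>2)" using e z by (subst ln_le_cancel_iff) auto
      then show ?thesis using sq unfolding l_def by linarith
    next
      \<comment> \<open>Here ln |z|^2 \<le> |z|^2 - 1 < -\<epsilon> \<le> -l, so the threshold
        \<open>l\<close> of the outer side serves the inner side too.\<close>
      case 2
      have "ln ((cmod z)\<^sup>2) \<le> (cmod z)\<^sup>2 - 1" using z by (intro ln_le_minus_one) simp
      then show ?thesis using sq 2 l(2) by linarith
    qed
  qed
  have "l * card (N - P) = (\<Sum>z\<in>N - P. l)" by simp
  also have "\<dots> \<le> (\<Sum>z\<in>N - P. 2 * \<bar>ln (cmod z)\<bar>)" by (intro sum_mono bad)
  also have "\<dots> \<le> (\<Sum>z\<in>N. 2 * \<bar>ln (cmod z)\<bar>)" by (intro sum_mono2 fin) auto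
  also have "\<dots> \<le> 2 * \<eta> * card N" using le by (simp add: sum_distrib_left[symmetric] N_def)
  finally have "l * card (N - P) \<le> 2 * \<eta> * card N" .
  moreover have "real (card (N - P)) = real (card N) - real (card P)"
    using card_Diff_subset[OF finite_subset[OF P fin] P] card_mono[OF fin P] by simp
  ultimately have "(card N - real (card P)) * l \<le> 2 * \<eta> * card N" by (simp add: mult.commute)
  then have "card N - real (card P) \<le> 2 * \<eta> * card N / l" by (rule iffD2[OF pos_le_divide_eq[OF l(1)]])
  then have "(card N - real (card P)) / card N \<le> 2 * \<eta> * card N / l / card N"
    using N0 by (intro divide_right_mono) auto
  also have "\<dots> = 2 * \<eta> / l" using N0 by simp
  finally have "1 - card P / card N \<le> 2 * \<eta> / l" using N0 by (simp add: diff_divide_distrib)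
  then show "1 - 2 * \<eta> / ln (1 + \<epsilon>) \<le> orbit_density \<Gamma> \<epsilon> x"
    unfolding dens l_def by linarith
qed

text \<open>Automorphisms over \<Gamma> preserve \<open>div_group \<Gamma>\<close> and hence the
  field it generates; the inverse automorphism shows that no element outside
  \<open>div_group \<Gamma>\<close> is moved into it.\<close>

lemma translate_exceptional:
  assumes a: "\<alpha> \<in> (adjoin (div_group \<Gamma>) - {0}) - div_group \<Gamma>" and b: "\<beta> \<in> Gal_orbit \<Gamma> \<alpha>"
  shows "\<beta> \<in> (adjoin (div_group \<Gamma>) - {0}) - div_group \<Gamma>"
proof -
  have aQ: "\<alpha> \<in> Qbar" using a adjoin_subset[OF subfield_Qbar div_group_Qbar] by blast
  obtain g where g: "g \<in> Gal_Qbar \<Gamma>" "\<beta> = g \<alpha>" using b by (auto simp: Gal_orbit_def)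
  obtain h where h: "h \<in> Gal_Qbar \<Gamma>" "h \<beta> = \<alpha>"
    using Gal_Qbar_inverse[OF g(1) \<Gamma>] g(2) aQ by metis
  have "\<beta> \<in> adjoin (div_group \<Gamma>)"
    unfolding g(2)
    by (rule Gal_Qbar_adjoin_image[OF g(1) div_group_Qbar])
       (use a Gal_Qbar_div_group[OF g(1)] subset_adjoin in blast)+
  moreover have "\<beta> \<noteq> 0" using h(2) hom_on_0[OF subfield_Qbar Gal_Qbar_hom[OF h(1)]] a by auto
  moreover have "\<beta> \<notin> div_group \<Gamma>" using h Gal_Qbar_div_group[OF h(1)] a by blast
  ultimately show ?thesis by simp
qed

end

section \<open>Equivalence of the height gap (A) and the sequence criterion (B)\<close>

theorem theorem1p2:
  fixes \<Gamma> :: "complex set"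
  assumes "subgroup \<Gamma> Cstar"
    and "\<Gamma> \<subseteq> Qbar"
    and "\<exists>S. finite S \<and> S \<subseteq> \<Gamma> \<and> generate Cstar S = \<Gamma>"
  shows "(\<exists>c>0. \<forall>\<alpha> \<in> (adjoin (div_group \<Gamma>) - {0}) - div_group \<Gamma>. weil_height \<alpha> \<ge> c)
    \<longleftrightarrow>
    (\<forall>y :: nat \<Rightarrow> complex.
       (\<forall>n. y n \<in> adjoin (div_group \<Gamma>) - {0}) \<and>
       (\<lambda>n. weil_height (y n)) \<longlonglongrightarrow> 0 \<and>
       (\<forall>\<epsilon>>0. (\<lambda>n. orbit_density \<Gamma> \<epsilon> (y n)) \<longlonglongrightarrow> 1)
       \<longrightarrow> (\<forall>\<^sub>F n in sequentially. y n \<in> div_group \<Gamma>))"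
    (is "?A \<longleftrightarrow> ?B")
proof
  assume ?A
  then obtain c where c: "c > 0" "\<And>\<alpha>. \<alpha> \<in> (adjoin (div_group \<Gamma>) - {0}) - div_group \<Gamma> \<Longrightarrow> weil_height \<alpha> \<ge> c"
    by blast
  show ?B
  proof (intro allI impI, elim conjE)
    fix y :: "nat \<Rightarrow> complex"
    assume y: "\<forall>n. y n \<in> adjoin (div_group \<Gamma>) - {0}" "(\<lambda>n. weil_height (y n)) \<longlonglongrightarrow> 0"
    have "\<forall>\<^sub>F n in sequentially. weil_height (y n) < c" using y(2) c(1) by (rule order_tendstoD)
    then show "\<forall>\<^sub>F n in sequentially. y n \<in> div_group \<Gamma>"
    proof eventually_elim
      case (elim n)
      then show ?case using c(2)[of "y n"] y(1) by fastforce
    qed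
  qed
next
  assume B: ?B
  note \<Gamma> = assms(2)
  define E where "E = (adjoin (div_group \<Gamma>) - {0}) - div_group \<Gamma>"
  have EQ: "E \<subseteq> Qbar" using adjoin_subset[OF subfield_Qbar div_group_Qbar] by (auto simp: E_def)
  obtain S where S: "finite S" "S \<subseteq> \<Gamma>" "generate Cstar S = \<Gamma>" using assms(3) by blast
  have "0 \<notin> S" using S(2) subgroup.subset[OF assms(1)] by auto
  then have "\<Gamma> \<subseteq> adjoin S" using generate_Cstar_subset_adjoin S(3) by blast
  then have "Gal_Qbar S \<subseteq> Gal_Qbar \<Gamma>"
    using Gal_Qbar_mono[of \<Gamma> "adjoin S"] Gal_Qbar_adjoin[of S] S(2) \<Gamma> by auto
  \<comment> \<open>Finite generation lets the finite set \<open>S\<close> stand in for \<Gamma> in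
    the counting bound with constant \<open>C\<close>.\<close>
  then have S_orbit: "Gal_orbit S \<alpha> \<subseteq> Gal_orbit \<Gamma> \<alpha>" for \<alpha> by (auto simp: Gal_orbit_def)
  obtain C where C: "\<And>\<alpha>. \<alpha> \<in> Qbar \<Longrightarrow> card (conjugates \<alpha>) \<le> C * card (Gal_orbit S \<alpha>)"
    using card_conjugates_le_Gal_orbit[OF S(1)] S(2) \<Gamma> by blast
  have translate: "\<exists>\<beta>. \<beta> \<in> Gal_orbit \<Gamma> \<alpha> \<and>
      (\<Sum>z\<in>Gal_orbit (roots_of_unity \<union> \<Gamma>) \<beta>. \<bar>ln (cmod z)\<bar>) \<le>
        2 * weil_height \<alpha> * C * card (Gal_orbit (roots_of_unity \<union> \<Gamma>) \<beta>)" if "\<alpha> \<in> E" for \<alpha>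
  proof -
    let ?f = "\<lambda>z. \<bar>ln (cmod z)\<bar>"
    have a: "\<alpha> \<in> Qbar" "algebraic \<alpha>" "\<alpha> \<noteq> 0" using that EQ by (auto simp: E_def Qbar_def)
    define G where "G = Gal_orbit \<Gamma> \<alpha>"
    obtain \<beta> where b: "\<beta> \<in> G"
      "sum ?f (Gal_orbit (roots_of_unity \<union> \<Gamma>) \<beta>) * card G \<le> card (Gal_orbit (roots_of_unity \<union> \<Gamma>) \<beta>) * sum ?f G"
      using exists_Gal_orbit_le_average[OF \<Gamma> a(1), of ?f] unfolding G_def by blast
    have G0: "card G > 0"
      using Gal_orbit_self[OF \<Gamma> a(1)] finite_Gal_orbit[OF a(1)] by (auto simp: G_def card_gt_0_iff)
    \<comment> \<open>All summands are nonnegative, so restricting to the orbit \<open>G\<close>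
      does not increase the sum, while the number of terms drops by at most the factor
      \<open>C\<close>.\<close>
    have "sum ?f G \<le> sum ?f (conjugates \<alpha>)"
      unfolding G_def by (intro sum_mono2 finite_conjugates Gal_orbit_conjugates a) simp
    also have "\<dots> \<le> 2 * weil_height \<alpha> * card (conjugates \<alpha>)" by (rule sum_abs_ln_le_weil_height[OF a(2,3)])
    also have "\<dots> \<le> 2 * weil_height \<alpha> * (C * card G)"
    proof (rule mult_left_mono)
      have "card (conjugates \<alpha>) \<le> C * card G"
        using C[OF a(1)] card_mono[OF finite_Gal_orbit[OF a(1)] S_orbit] unfolding G_def
        by (meson le_trans mult_le_mono2)
      then show "real (card (conjugates \<alpha>)) \<le> real (C * card G)" by (simp only: of_nat_le_iff)
    qed (use weil_height_nonneg[OF a(2)] in simp)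
    finally have "card (Gal_orbit (roots_of_unity \<union> \<Gamma>) \<beta>) * sum ?f G
        \<le> card (Gal_orbit (roots_of_unity \<union> \<Gamma>) \<beta>) * (2 * weil_height \<alpha> * (C * card G))"
      by (rule mult_left_mono) simp
    then have "sum ?f (Gal_orbit (roots_of_unity \<union> \<Gamma>) \<beta>) * card G
        \<le> (2 * weil_height \<alpha> * C * card (Gal_orbit (roots_of_unity \<union> \<Gamma>) \<beta>)) * card G"
      using b(2) by (simp add: mult_ac)
    then have "sum ?f (Gal_orbit (roots_of_unity \<union> \<Gamma>) \<beta>)
        \<le> 2 * weil_height \<alpha> * C * card (Gal_orbit (roots_of_unity \<union> \<Gamma>) \<beta>)"
      by (rule mult_right_le_imp_le) (use G0 in simp)
    then show ?thesis using b(1) by (auto simp: G_def)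
  qed
  show ?A
  proof (rule ccontr)
    assume "\<not> ?A"
    then have "\<forall>c>0. \<exists>\<alpha>\<in>E. weil_height \<alpha> < c" unfolding E_def by (meson not_le)
    \<comment> \<open>The failure of (A) is used with c = 1/(n + 1).\<close>
    then have "\<exists>\<alpha>\<in>E. weil_height \<alpha> < inverse (real (Suc n))" for n by simp
    then obtain a where a: "\<And>n. a n \<in> E" "\<And>n. weil_height (a n) < inverse (real (Suc n))" by metis
    have aQ: "a n \<in> Qbar" "algebraic (a n)" for n using a(1) EQ by (auto simp: Qbar_def)
    have lim: "(\<lambda>n. weil_height (a n)) \<longlonglongrightarrow> 0"
    proof (rule tendsto_sandwich[OF _ _ tendsto_const LIMSEQ_inverse_real_of_nat])
      show "\<forall>\<^sub>F n in sequentially. 0 \<le> weil_height (a n)"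
        by (intro always_eventually allI weil_height_nonneg aQ(2))
      show "\<forall>\<^sub>F n in sequentially. weil_height (a n) \<le> inverse (real (Suc n))"
        by (intro always_eventually allI less_imp_le a(2))
    qed
    obtain y where y: "\<And>n. y n \<in> Gal_orbit \<Gamma> (a n)"
      and sum_y: "\<And>n. (\<Sum>z\<in>Gal_orbit (roots_of_unity \<union> \<Gamma>) (y n). \<bar>ln (cmod z)\<bar>) \<le>
        2 * weil_height (a n) * C * card (Gal_orbit (roots_of_unity \<union> \<Gamma>) (y n))"
      using translate[OF a(1)] by metis
    \<comment> \<open>Passing from \<open>a n\<close> to its conjugate \<open>y n\<close> keeps it
      outside \<open>div_group \<Gamma>\<close> and keeps the height.\<close>
    have yE: "y n \<in> E" for n using translate_exceptional[OF \<Gamma> _ y] a(1) unfolding E_def by blast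
    have "weil_height (y n) = weil_height (a n)" for n
      using weil_height_conjugate[OF aQ(2)] y Gal_orbit_conjugates[OF aQ(1)] by blast
    then have "(\<lambda>n. weil_height (y n)) \<longlonglongrightarrow> 0" using lim by simp
    moreover have "(\<lambda>n. orbit_density \<Gamma> \<epsilon> (y n)) \<longlonglongrightarrow> 1" if e: "\<epsilon> > 0" for \<epsilon>
    proof (rule tendsto_sandwich)
      have yn: "y n \<in> Qbar" "y n \<noteq> 0" for n using yE EQ by (auto simp: E_def)
      note dens = orbit_density_ge[OF \<Gamma> yn e sum_y]
      show "\<forall>\<^sub>F n in sequentially. 1 - 2 * (2 * weil_height (a n) * C) / ln (1 + \<epsilon>) \<le> orbit_density \<Gamma> \<epsilon> (y n)"
        "\<forall>\<^sub>F n in sequentially. orbit_density \<Gamma> \<epsilon> (y n) \<le> 1"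
        using dens by simp_all
      \<comment> \<open>The mean bound 2 h(a n) C in the role of \<eta> tends to 0, for fixed
        \<epsilon> and with \<open>C\<close> independent of \<open>n\<close>.\<close>
      have "(\<lambda>n. 1 - 2 * (2 * weil_height (a n) * C) / ln (1 + \<epsilon>)) \<longlonglongrightarrow> 1 - 2 * (2 * 0 * real C) / ln (1 + \<epsilon>)"
        using ln_gt_zero[of "1 + \<epsilon>"] e
        by (intro tendsto_diff tendsto_divide tendsto_mult tendsto_const lim) auto
      then show "(\<lambda>n. 1 - 2 * (2 * weil_height (a n) * C) / ln (1 + \<epsilon>)) \<longlonglongrightarrow> 1" by simp
    qed (rule tendsto_const)
    ultimately have "\<forall>\<^sub>F n in sequentially. y n \<in> div_group \<Gamma>"
      using B yE unfolding E_def by blast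
    then have "\<forall>\<^sub>F n :: nat in sequentially. False" using yE by (simp add: E_def)
    then show False by simp
  qed
qed

end
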